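(* For $m\ge1$, the graphs $X_{3m}$ form an infinite family of vertex-transitive 3-RDR graphs, $X_{3m}$ having order $36m$, and no $X_{3m}$ is isomorphic to a honeycomb toroidal graph or to a generalized Petersen graph.
   Context: Definition of $X_n$, $n\ge 3$: let $D_n=\langle r,z\mid r^n=z^2=(zr)^2=1\rangle$ be the dihedral group of order $2n$, let $S_3$ be the symmetric group on $\{1,2,3\}$, and let $G=S_3\times D_n$. Put $a=((1\,2),1)$, $b=((1\,3),z)$, $c=((2\,3),zr)$ and $S=\{a,b,c\}$. Then $X_n=\mathrm{Cay}(G,S)$ is the graph with vertex set $G$ and edge set $\{\{g,gs\}: g\in G, s\in S\}$. All graphs are finite and simple. For a graph with vertex set $V$, $N(v)$ is the open neighbourhood of $v$. A $3$-rainbow dominating function (3-RDF) is a map $f\colon V\to 2^{\{1,2,3\}}$ such that $f(v)=\emptyset$ implies $\bigcup_{u\in N(v)}f(u)=\{1,2,3\}$, for all $v\in V$; $\gamma_{r3}$ is the minimum of $\sum_{v}|f(v)|$ over all 3-RDFs. A cubic (3-regular) graph is 3-RDR (3-rainbow domination regular) if $\gamma_{r3}=|V|/2$ (the known lower bound for cubic graphs). For $1\le k\le n/2$, the generalized Petersen graph $\mathrm{GP}(n,k)$ has vertex set $\{u_i,v_i: i\in\mathbb Z_n\}$ and edges $\{u_i,u_{i+1}\}$, $\{u_i,v_i\}$, $\{v_i,v_{i+k}\}$, $i\in\mathbb Z_n$. For integers $m\ge1$, even $n\ge4$, and $0\le\ell\le n/2$ with $\ell\equiv m\pmod 2$, the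 honeycomb toroidal graph $\mathrm{HTG}(m,n,\ell)$ has vertex set $\{v_{i,j}: i\in\mathbb Z_m, j\in\mathbb Z_n\}$ and edge set the disjoint union of: vertical edges $\{v_{i,j},v_{i,j+1}\}$ for $i\in\mathbb Z_m$, $j\in\mathbb Z_n$; horizontal edges $\{v_{i,j},v_{i+1,j}\}$ for $i\in\mathbb Z_m\setminus\{m-1\}$, $j\in\mathbb Z_n$, $i+1\equiv j\pmod 2$; and jumps $\{v_{m-1,j},v_{0,j+\ell}\}$ for $j\in\mathbb Z_n$, $j\equiv m\pmod 2$. *)

theory Defs
  imports Complex_Main "HOL-Algebra.Sym_Groups" "HOL-Number_Theory.Cong"
begin

section \<open>Finite simple graphs\<close>

record 'a ugraph =
  verts :: "'a set"
  edges :: "'a set set"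

definition simple_graph :: "'a ugraph \<Rightarrow> bool" where
  "simple_graph X \<longleftrightarrow> finite (verts X) \<and> (\<forall>e\<in>edges X. e \<subseteq> verts X \<and> card e = 2)"

definition nbhd :: "'a ugraph \<Rightarrow> 'a \<Rightarrow> 'a set" where
  "nbhd X v = {u \<in> verts X. {u, v} \<in> edges X}"

definition cubic :: "'a ugraph \<Rightarrow> bool" where
  "cubic X \<longleftrightarrow> simple_graph X \<and> (\<forall>v\<in>verts X. card (nbhd X v) = 3)"

definition graph_iso :: "('a \<Rightarrow> 'b) \<Rightarrow> 'a ugraph \<Rightarrow> 'b ugraph \<Rightarrow> bool" where
  "graph_iso \<phi> X Y \<longleftrightarrow> bij_betw \<phi> (verts X) (verts Y) \<and>
     (\<forall>u\<in>verts X. \<forall>v\<in>verts X. {u, v} \<in> edges X \<longleftrightarrow> {\<phi> u, \<phi> v} \<in> edges Y)"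

definition isomorphic :: "'a ugraph \<Rightarrow> 'b ugraph \<Rightarrow> bool" where
  "isomorphic X Y \<longleftrightarrow> (\<exists>\<phi>. graph_iso \<phi> X Y)"

definition vertex_transitive :: "'a ugraph \<Rightarrow> bool" where
  "vertex_transitive X \<longleftrightarrow> (\<forall>u\<in>verts X. \<forall>v\<in>verts X. \<exists>\<phi>. graph_iso \<phi> X X \<and> \<phi> u = v)"

section \<open>3-rainbow domination\<close>

text \<open>Values of \<open>f\<close> outside the vertex set play no role.\<close>

definition is_3RDF :: "'a ugraph \<Rightarrow> ('a \<Rightarrow> nat set) \<Rightarrow> bool" where
  "is_3RDF X f \<longleftrightarrow> (\<forall>v\<in>verts X. f v \<subseteq> {1, 2, 3} \<and>
     (f v = {} \<longrightarrow> (\<Union>u\<in>nbhd X v. f u) = {1, 2, 3}))"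

definition gamma_r3 :: "'a ugraph \<Rightarrow> nat" where
  "gamma_r3 X = (LEAST w. \<exists>f. is_3RDF X f \<and> w = (\<Sum>v\<in>verts X. card (f v)))"

definition is_3RDR :: "'a ugraph \<Rightarrow> bool" where
  "is_3RDR X \<longleftrightarrow> cubic X \<and> real (gamma_r3 X) = real (card (verts X)) / 2"

section \<open>Groups given by generators and relations\<close>

text \<open>
  A word is a list of letters \<open>(x, True)\<close>, standing for the generator \<open>x\<close>, and \<open>(x, False)\<close>,
  standing for its inverse. The group presented by a set \<open>R\<close> of relators is the quotient of the
  monoid of words by the congruence generated by free cancellation and by deletion of relators.
\<close>

type_synonym 'g gword = "('g \<times> bool) list"

inductive pres_eq :: "'g gword set \<Rightarrow> 'g gword \<Rightarrow> 'g gword \<Rightarrow> bool" for R where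
  refl: "pres_eq R w w"
| sym: "pres_eq R v w \<Longrightarrow> pres_eq R w v"
| trans: "pres_eq R u v \<Longrightarrow> pres_eq R v w \<Longrightarrow> pres_eq R u w"
| cancel: "pres_eq R (u @ [(x, b), (x, \<not> b)] @ v) (u @ v)"
| relator: "w \<in> R \<Longrightarrow> pres_eq R (u @ w @ v) (u @ v)"

definition pres_class :: "'g gword set \<Rightarrow> 'g gword \<Rightarrow> 'g gword set" where
  "pres_class R w = {v. pres_eq R w v}"

definition presented_group :: "'g gword set \<Rightarrow> 'g gword set monoid" where
  "presented_group R =
     \<lparr> carrier = range (pres_class R),
       mult = (\<lambda>A B. \<Union>u\<in>A. \<Union>v\<in>B. pres_class R (u @ v)),
       one = pres_class R [] \<rparr>"

lemma pres_eq_ctxt: "pres_eq R v w \<Longrightarrow> pres_eq R (a @ v @ b) (a @ w @ b)"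
proof (induction rule: pres_eq.induct)
  case (refl w)
  show ?case by (rule pres_eq.refl)
next
  case (sym v w)
  show ?case by (rule pres_eq.sym[OF sym.IH])
next
  case (trans u v w)
  show ?case by (rule pres_eq.trans[OF trans.IH])
next
  case (cancel u x c v)
  show ?case using pres_eq.cancel[of R "a @ u" x c "v @ b"] by simp
next
  case (relator w u v)
  then show ?case using pres_eq.relator[of w R "a @ u" "v @ b"] by simp
qed

lemma pres_eq_append:
  assumes "pres_eq R u u'" "pres_eq R v v'"
  shows "pres_eq R (u @ v) (u' @ v')"
proof (rule pres_eq.trans)
  show "pres_eq R (u @ v) (u' @ v)" using pres_eq_ctxt[OF assms(1), of "[]" v] by simp
  show "pres_eq R (u' @ v) (u' @ v')" using pres_eq_ctxt[OF assms(2), of u' "[]"] by simp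
qed

lemma pres_class_eq_iff: "pres_class R u = pres_class R v \<longleftrightarrow> pres_eq R u v"
proof
  assume "pres_class R u = pres_class R v"
  moreover have "v \<in> pres_class R v" by (simp add: pres_class_def pres_eq.refl)
  ultimately show "pres_eq R u v" by (auto simp: pres_class_def)
next
  assume uv: "pres_eq R u v"
  have "pres_eq R u w \<longleftrightarrow> pres_eq R v w" for w
    using pres_eq.trans[OF uv] pres_eq.trans[OF pres_eq.sym[OF uv]] by iprover
  then show "pres_class R u = pres_class R v" by (simp add: pres_class_def)
qed

lemma presented_group_mult:
  "pres_class R u \<otimes>\<^bsub>presented_group R\<^esub> pres_class R v = pres_class R (u @ v)"
proof -
  have "pres_class R (u' @ v') = pres_class R (u @ v)"
    if "u' \<in> pres_class R u" "v' \<in> pres_class R v" for u' v'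
  proof -
    have "pres_eq R u u'" "pres_eq R v v'" using that by (simp_all add: pres_class_def)
    from pres_eq_append[OF this] show ?thesis by (simp add: pres_class_eq_iff pres_eq.sym)
  qed
  moreover have "u \<in> pres_class R u" "v \<in> pres_class R v"
    by (simp_all add: pres_class_def pres_eq.refl)
  ultimately have "(\<Union>u'\<in>pres_class R u. \<Union>v'\<in>pres_class R v. pres_class R (u' @ v'))
      = pres_class R (u @ v)"
    by blast
  then show ?thesis by (simp add: presented_group_def)
qed

lemma pres_eq_inverse: "pres_eq R (map (\<lambda>(x, b). (x, \<not> b)) (rev w) @ w) []"
proof (induction w)
  case Nil
  show ?case by (simp add: pres_eq.refl)
next
  case (Cons l w)
  obtain x b where l: "l = (x, b)" by force
  have "pres_eq R (map (\<lambda>(x, b). (x, \<not> b)) (rev (l # w)) @ l # w)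
      (map (\<lambda>(x, b). (x, \<not> b)) (rev w) @ w)"
    using pres_eq.cancel[of R "map (\<lambda>(x, b). (x, \<not> b)) (rev w)" x "\<not> b" w] by (simp add: l)
  from pres_eq.trans[OF this Cons.IH] show ?case .
qed

lemma presented_group_is_group: "group (presented_group R)"
proof (rule groupI)
  let ?G = "presented_group R"
  have carr: "carrier ?G = range (pres_class R)" and one: "\<one>\<^bsub>?G\<^esub> = pres_class R []"
    by (simp_all add: presented_group_def)
  show "\<And>x y. x \<in> carrier ?G \<Longrightarrow> y \<in> carrier ?G \<Longrightarrow> x \<otimes>\<^bsub>?G\<^esub> y \<in> carrier ?G"
    by (auto simp: carr presented_group_mult)
  show "\<one>\<^bsub>?G\<^esub> \<in> carrier ?G"
    by (simp add: carr one)
  show "\<And>x y z. x \<in> carrier ?G \<Longrightarrow> y \<in> carrier ?G \<Longrightarrow> z \<in> carrier ?G \<Longrightarrow>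
      (x \<otimes>\<^bsub>?G\<^esub> y) \<otimes>\<^bsub>?G\<^esub> z = x \<otimes>\<^bsub>?G\<^esub> (y \<otimes>\<^bsub>?G\<^esub> z)"
    by (auto simp: carr presented_group_mult)
  show "\<And>x. x \<in> carrier ?G \<Longrightarrow> \<one>\<^bsub>?G\<^esub> \<otimes>\<^bsub>?G\<^esub> x = x"
    by (auto simp: carr one presented_group_mult)
  show "\<exists>y\<in>carrier ?G. y \<otimes>\<^bsub>?G\<^esub> x = \<one>\<^bsub>?G\<^esub>" if x: "x \<in> carrier ?G" for x
  proof -
    obtain w where "x = pres_class R w" using x by (auto simp: carr)
    then have "pres_class R (map (\<lambda>(x, b). (x, \<not> b)) (rev w)) \<otimes>\<^bsub>?G\<^esub> x = \<one>\<^bsub>?G\<^esub>"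
      by (simp add: presented_group_mult one pres_class_eq_iff pres_eq_inverse)
    then show ?thesis by (auto simp: carr)
  qed
qed

section \<open>The graphs $X_n$\<close>

datatype dih_gen = Gen_r | Gen_z

definition dih_relators :: "nat \<Rightarrow> dih_gen gword set" where
  "dih_relators n =
     {replicate n (Gen_r, True),
      [(Gen_z, True), (Gen_z, True)],
      [(Gen_z, True), (Gen_r, True), (Gen_z, True), (Gen_r, True)]}"

definition dihedral_group :: "nat \<Rightarrow> dih_gen gword set monoid" where
  "dihedral_group n = presented_group (dih_relators n)"

definition dih_r :: "nat \<Rightarrow> dih_gen gword set" where
  "dih_r n = pres_class (dih_relators n) [(Gen_r, True)]"

definition dih_z :: "nat \<Rightarrow> dih_gen gword set" where
  "dih_z n = pres_class (dih_relators n) [(Gen_z, True)]"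

definition cayley_graph :: "('a, 'b) monoid_scheme \<Rightarrow> 'a set \<Rightarrow> 'a ugraph" where
  "cayley_graph G S =
     \<lparr> verts = carrier G, edges = {{g, g \<otimes>\<^bsub>G\<^esub> s} | g s. g \<in> carrier G \<and> s \<in> S} \<rparr>"

definition X_graph :: "nat \<Rightarrow> ((nat \<Rightarrow> nat) \<times> dih_gen gword set) ugraph" where
  "X_graph n =
     cayley_graph (sym_group 3 \<times>\<times> dihedral_group n)
       {(transpose 1 2, \<one>\<^bsub>dihedral_group n\<^esub>),
        (transpose 1 3, dih_z n),
        (transpose 2 3, dih_z n \<otimes>\<^bsub>dihedral_group n\<^esub> dih_r n)}"

section \<open>Generalized Petersen graphs and honeycomb toroidal graphs\<close>

text \<open>
  Residues modulo \<open>n\<close> are represented by \<open>{0..<n}\<close>. In \<open>GP_graph\<close>, \<open>Inl i\<close> is $u_i$ and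
  \<open>Inr i\<close> is $v_i$.
\<close>

definition GP_graph :: "nat \<Rightarrow> nat \<Rightarrow> (nat + nat) ugraph" where
  "GP_graph n k =
     \<lparr> verts = Inl ` {0..<n} \<union> Inr ` {0..<n},
       edges = {{Inl i, Inl ((i + 1) mod n)} | i. i < n} \<union>
               {{Inl i, Inr i} | i. i < n} \<union>
               {{Inr i, Inr ((i + k) mod n)} | i. i < n} \<rparr>"

definition is_generalized_petersen :: "'a ugraph \<Rightarrow> bool" where
  "is_generalized_petersen X \<longleftrightarrow>
     (\<exists>n k. 1 \<le> k \<and> real k \<le> real n / 2 \<and> isomorphic X (GP_graph n k))"

text \<open>
  For \<open>m = 1\<close> and \<open>l = 1\<close> every jump coincides with a vertical edge, so the three kinds of edges
  are not disjoint and the union below is a cycle; this parameter pair is not excluded.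
\<close>

definition HTG_graph :: "nat \<Rightarrow> nat \<Rightarrow> nat \<Rightarrow> (nat \<times> nat) ugraph" where
  "HTG_graph m n l =
     \<lparr> verts = {0..<m} \<times> {0..<n},
       edges = {{(i, j), (i, (j + 1) mod n)} | i j. i < m \<and> j < n} \<union>
               {{(i, j), (i + 1, j)} | i j. i + 1 < m \<and> j < n \<and> [i + 1 = j] (mod 2)} \<union>
               {{(m - 1, j), (0, (j + l) mod n)} | j. j < n \<and> [j = m] (mod 2)} \<rparr>"

definition is_honeycomb_toroidal :: "'a ugraph \<Rightarrow> bool" where
  "is_honeycomb_toroidal X \<longleftrightarrow>
     (\<exists>m n l. m \<ge> 1 \<and> even n \<and> n \<ge> 4 \<and> real l \<le> real n / 2 \<and> [l = m] (mod 2) \<and>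
        isomorphic X (HTG_graph m n l))"

end

theory Submission
  imports Defs
begin

text \<open>
  All generators are odd in the factor \<open>S\<^sub>3\<close>, and the three neighbours of a vertex with odd
  permutation have the three different even permutations; so colouring the even vertices by
  their permutation gives a 3-rainbow dominating function of weight \<open>|V|/2\<close>.

  For \<open>n = 3 m\<close> the \<open>a\<close>-edges are invariant under automorphisms, because closed non-backtracking
  walks through them are counted differently: for \<open>n = 3\<close> exactly the \<open>b\<close>- and \<open>c\<close>-edges lie on
  a 6-cycle, and for \<open>n \<ge> 6\<close> each \<open>a\<close>-edge lies on six and each other edge on five 8-cycles.
  No \<open>a\<close>-edge lies on a 6-cycle, whereas a cubic honeycomb toroidal graph has a
  vertex all of whose edges lie on hexagons.  In a generalized Petersen graph the rotation forces the
  outer rim, of length \<open>6 n\<close>, to avoid the \<open>a\<close>-edges; but the cycles formed by the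
  remaining edges have length \<open>2 n\<close>, since \<open>b c\<close> has order \<open>lcm 3 n = n\<close>.
\<close>

section \<open>Isomorphisms and domination in cubic graphs\<close>

lemma graph_iso_inv:
  assumes "graph_iso \<phi> X Y"
  shows "graph_iso (inv_into (verts X) \<phi>) Y X"
proof -
  let ?i = "inv_into (verts X) \<phi>"
  have b: "bij_betw \<phi> (verts X) (verts Y)"
    using assms by (simp add: graph_iso_def)
  have i: "?i u \<in> verts X" "\<phi> (?i u) = u" if "u \<in> verts Y" for u
    using b that by (auto simp: bij_betw_def inv_into_into f_inv_into_f)
  have "{u, v} \<in> edges Y \<longleftrightarrow> {?i u, ?i v} \<in> edges X" if "u \<in> verts Y" "v \<in> verts Y" for u v
    using assms i[OF that(1)] i[OF that(2)] unfolding graph_iso_def by metis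
  then show ?thesis
    using bij_betw_inv_into[OF b] by (simp add: graph_iso_def)
qed

lemma graph_iso_compose:
  assumes "graph_iso \<phi> X Y" "graph_iso \<psi> Y Z"
  shows "graph_iso (\<psi> \<circ> \<phi>) X Z"
proof -
  have "\<phi> u \<in> verts Y" if "u \<in> verts X" for u
    using assms(1) that by (auto simp: graph_iso_def bij_betw_def)
  then show ?thesis
    using assms bij_betw_trans[of \<phi> "verts X" "verts Y" \<psi> "verts Z"]
    by (simp add: graph_iso_def)
qed

lemma graph_iso_in_verts: "graph_iso \<phi> X Y \<Longrightarrow> u \<in> verts X \<Longrightarrow> \<phi> u \<in> verts Y"
  by (auto simp: graph_iso_def bij_betw_def)

lemma graph_iso_inj: "graph_iso \<phi> X Y \<Longrightarrow> inj_on \<phi> (verts X)"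
  by (simp add: graph_iso_def bij_betw_def)

lemma graph_iso_nbhd:
  assumes "graph_iso \<phi> X Y" "v \<in> verts X"
  shows "nbhd Y (\<phi> v) = \<phi> ` nbhd X v"
proof -
  have im: "verts Y = \<phi> ` verts X"
    using assms(1) by (simp add: graph_iso_def bij_betw_def)
  have "{\<phi> u, \<phi> v} \<in> edges Y \<longleftrightarrow> {u, v} \<in> edges X" if "u \<in> verts X" for u
    using assms that by (simp add: graph_iso_def)
  then show ?thesis
    unfolding nbhd_def im by auto
qed

lemma nbhd_subset_verts: "nbhd X v \<subseteq> verts X"
  by (auto simp: nbhd_def)

lemma isomorphic_card_verts: "isomorphic X Y \<Longrightarrow> card (verts X) = card (verts Y)"
  by (auto simp: isomorphic_def graph_iso_def bij_betw_same_card)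

lemma vertex_transitive_iso:
  assumes \<phi>: "graph_iso \<phi> X Y" and X: "vertex_transitive X"
  shows "vertex_transitive Y"
  unfolding vertex_transitive_def
proof (intro ballI)
  fix u v assume uv: "u \<in> verts Y" "v \<in> verts Y"
  let ?i = "inv_into (verts X) \<phi>"
  have i: "graph_iso ?i Y X" by (rule graph_iso_inv[OF \<phi>])
  obtain \<alpha> where \<alpha>: "graph_iso \<alpha> X X" "\<alpha> (?i u) = ?i v"
    using X graph_iso_in_verts[OF i] uv unfolding vertex_transitive_def by meson
  have "graph_iso (\<phi> \<circ> (\<alpha> \<circ> ?i)) Y Y"
    by (intro graph_iso_compose[OF _ \<phi>] graph_iso_compose[OF i] \<alpha>)
  moreover have "(\<phi> \<circ> (\<alpha> \<circ> ?i)) u = v"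
    using \<alpha>(2) uv(2) \<phi> by (simp add: graph_iso_def bij_betw_def f_inv_into_f)
  ultimately show "\<exists>\<phi>. graph_iso \<phi> Y Y \<and> \<phi> u = v" by blast
qed

text \<open>Each empty vertex receives weight at least 3 from its neighbourhood, and each vertex
  gives its weight to three neighbours; so the empty vertices are outweighed, and trivially so are
  the nonempty ones.\<close>

lemma cubic_3RDF_weight:
  assumes X: "cubic X" and f: "is_3RDF X f"
  shows "card (verts X) \<le> 2 * (\<Sum>v\<in>verts X. card (f v))"
proof -
  let ?V = "verts X" and ?W = "\<Sum>v\<in>verts X. card (f v)"
  let ?E = "{v \<in> ?V. f v = {}}"
  have fin: "finite ?V" using X by (simp add: cubic_def simple_graph_def)
  have f_sub: "f v \<subseteq> {1, 2, 3}" if "v \<in> ?V" for v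
    using f that by (simp add: is_3RDF_def)
  then have f_fin: "finite (f v)" if "v \<in> ?V" for v
    using that by (meson finite.emptyI finite.insertI finite_subset)
  have sym: "{v \<in> ?V. {u, v} \<in> edges X} = nbhd X u" for u
    by (simp add: nbhd_def insert_commute)
  have "(\<Sum>v\<in>?V. \<Sum>u\<in>nbhd X v. card (f u)) = (\<Sum>u\<in>?V. \<Sum>v\<in>nbhd X u. card (f u))"
    using sum.swap_restrict[OF fin fin, of "\<lambda>v u. card (f u)" "\<lambda>v u. {u, v} \<in> edges X"]
    by (simp only: sym nbhd_def[symmetric])
  also have "\<dots> = 3 * ?W"
    using X by (simp add: cubic_def sum_distrib_left)
  finally have total: "(\<Sum>v\<in>?V. \<Sum>u\<in>nbhd X v. card (f u)) = 3 * ?W" .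
  have "3 \<le> (\<Sum>u\<in>nbhd X v. card (f u))" if "v \<in> ?E" for v
  proof -
    have "3 = card (\<Union>u\<in>nbhd X v. f u)"
      using f that by (simp add: is_3RDF_def)
    also have "\<dots> \<le> (\<Sum>u\<in>nbhd X v. card (f u))"
      using finite_subset[OF nbhd_subset_verts fin] by (rule card_UN_le)
    finally show ?thesis .
  qed
  then have "(\<Sum>v\<in>?E. 3) \<le> (\<Sum>v\<in>?E. \<Sum>u\<in>nbhd X v. card (f u))"
    by (rule sum_mono)
  also have "\<dots> \<le> 3 * ?W"
    unfolding total[symmetric] using fin by (intro sum_mono2) auto
  finally have "card ?E \<le> ?W" by simp
  moreover have "card (?V - ?E) \<le> ?W"
  proof -
    have "1 \<le> card (f v)" if "v \<in> ?V - ?E" for v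
      using that f_fin[of v] by (simp add: Suc_le_eq card_gt_0_iff)
    then have "(\<Sum>v\<in>?V - ?E. 1) \<le> (\<Sum>v\<in>?V - ?E. card (f v))" by (rule sum_mono)
    also have "\<dots> \<le> ?W" using fin by (intro sum_mono2) auto
    finally show ?thesis by simp
  qed
  moreover have "card ?V = card ?E + card (?V - ?E)"
    using fin card_mono[of ?V ?E] by (simp add: card_Diff_subset)
  ultimately show ?thesis by simp
qed

text \<open>The weight of \<open>f\<close> attains the lower bound of
  \<open>cubic_3RDF_weight\<close>, so \<open>f\<close> is minimal.\<close>

lemma is_3RDR_I:
  assumes X: "cubic X" and f: "is_3RDF X f"
    and weight: "2 * (\<Sum>v\<in>verts X. card (f v)) = card (verts X)"
  shows "is_3RDR X"
proof -
  have "gamma_r3 X = (\<Sum>v\<in>verts X. card (f v))"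
    unfolding gamma_r3_def
  proof (rule Least_equality)
    show "\<exists>g. is_3RDF X g \<and> (\<Sum>v\<in>verts X. card (f v)) = (\<Sum>v\<in>verts X. card (g v))"
      using f by blast
    show "(\<Sum>v\<in>verts X. card (f v)) \<le> w"
      if "\<exists>g. is_3RDF X g \<and> w = (\<Sum>v\<in>verts X. card (g v))" for w
      using that cubic_3RDF_weight[OF X] weight by fastforce
  qed
  moreover have "real (card (verts X)) = 2 * real (\<Sum>v\<in>verts X. card (f v))"
    using weight by linarith
  ultimately show ?thesis
    using X by (simp add: is_3RDR_def)
qed

section \<open>Counting non-backtracking walks\<close>

text \<open>\<open>arc_walks X L (u, v) (u', v')\<close> counts the non-backtracking walks whose first arc is
  \<open>(u, v)\<close> and whose last arc, \<open>L\<close> steps later, is \<open>(u', v')\<close>.  For equal arcs these are the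
  closed walks of length \<open>L\<close> that do not backtrack even at their base point.\<close>

fun arc_walks :: "'a ugraph \<Rightarrow> nat \<Rightarrow> 'a \<times> 'a \<Rightarrow> 'a \<times> 'a \<Rightarrow> nat" where
  "arc_walks X 0 p q = (if p = q then 1 else 0)"
| "arc_walks X (Suc L) p q = (\<Sum>w\<in>nbhd X (snd p) - {fst p}. arc_walks X L (snd p, w) q)"

text \<open>An isomorphism maps the admissible continuations of an arc bijectively onto those of its
  image. The counts thus compare arcs under translations, under arbitrary automorphisms and across
  isomorphic graphs.\<close>

lemma arc_walks_iso:
  assumes \<phi>: "graph_iso \<phi> X Y" and "u' \<in> verts X" "v' \<in> verts X"
  shows "u \<in> verts X \<Longrightarrow> v \<in> verts X \<Longrightarrow>
    arc_walks Y L (\<phi> u, \<phi> v) (\<phi> u', \<phi> v') = arc_walks X L (u, v) (u', v')"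
proof (induction L arbitrary: u v)
  case 0
  then show ?case
    using graph_iso_inj[OF \<phi>] assms(2,3) by (simp add: inj_on_eq_iff)
next
  case (Suc L)
  let ?N = "nbhd X v - {u}"
  have sub: "?N \<subseteq> verts X"
    using nbhd_subset_verts by fast
  have "nbhd Y (\<phi> v) - {\<phi> u} = \<phi> ` nbhd X v - \<phi> ` {u}"
    using graph_iso_nbhd[OF \<phi> Suc.prems(2)] by simp
  also have "\<dots> = \<phi> ` ?N"
    by (rule inj_on_image_set_diff[OF graph_iso_inj[OF \<phi>], symmetric])
      (use sub Suc.prems(1) in auto)
  finally have im: "nbhd Y (\<phi> v) - {\<phi> u} = \<phi> ` ?N" .
  have "arc_walks Y (Suc L) (\<phi> u, \<phi> v) (\<phi> u', \<phi> v')
      = (\<Sum>w\<in>\<phi> ` ?N. arc_walks Y L (\<phi> v, w) (\<phi> u', \<phi> v'))"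
    by (simp only: arc_walks.simps prod.sel im)
  also have "\<dots> = (\<Sum>w\<in>?N. arc_walks Y L (\<phi> v, \<phi> w) (\<phi> u', \<phi> v'))"
    using inj_on_subset[OF graph_iso_inj[OF \<phi>] sub] by (simp only: sum.reindex o_def)
  also have "\<dots> = (\<Sum>w\<in>?N. arc_walks X L (v, w) (u', v'))"
    by (intro sum.cong[OF HOL.refl] Suc.IH Suc.prems(2)) (use sub in blast)
  also have "\<dots> = arc_walks X (Suc L) (u, v) (u', v')"
    by (simp only: arc_walks.simps prod.sel)
  finally show ?case .
qed

lemma arc_walks_Suc_pos:
  assumes "finite (verts X)" "w \<in> nbhd X v" "w \<noteq> u" "arc_walks X L (v, w) q > 0"
  shows "arc_walks X (Suc L) (u, v) q > 0"
proof -
  have "finite (nbhd X v - {u})"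
    using finite_subset[OF nbhd_subset_verts assms(1)] by simp
  then have "arc_walks X L (v, w) q \<le> (\<Sum>w\<in>nbhd X v - {u}. arc_walks X L (v, w) q)"
    using assms(2,3) member_le_sum[of w "nbhd X v - {u}" "\<lambda>w. arc_walks X L (v, w) q"] by simp
  then show ?thesis using assms(4) by simp
qed

section \<open>A coordinate model\<close>

text \<open>A vertex \<open>(x, e, k, d)\<close> with signs \<open>e, d \<in> {1, -1}\<close> encodes the pair of a permutation
  \<open>(1 2 3)\<^sup>x\<close> (times \<open>(1 2)\<close> if \<open>e = -1\<close>) and a dihedral element \<open>r\<^sup>k\<close> (times \<open>z\<close> if
  \<open>d = -1\<close>); \<open>step n A\<close>, \<open>step n B\<close>, \<open>step n C\<close> are right multiplication by \<open>a\<close>, \<open>b\<close>, \<open>c\<close>.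
  Since reduction modulo 0 is the identity, \<open>n = 0\<close> gives the infinite dihedral group.\<close>

datatype gen = A | B | C

type_synonym coord = "int \<times> int \<times> int \<times> int"

fun step :: "int \<Rightarrow> gen \<Rightarrow> coord \<Rightarrow> coord" where
  "step n A (x, e, k, d) = (x, - e, k, d)"
| "step n B (x, e, k, d) = ((x + e) mod 3, - e, k, - d)"
| "step n C (x, e, k, d) = ((x + 2 * e) mod 3, - e, (k - d) mod n, - d)"

definition origin :: coord where
  "origin = (0, 1, 0, 1)"

definition coords :: "nat \<Rightarrow> coord set" where
  "coords n = {0..<3} \<times> {1, -1} \<times> {0..<int n} \<times> {1, -1}"

definition coord_graph :: "nat \<Rightarrow> coord ugraph" where
  "coord_graph n = \<lparr> verts = coords n, edges = {{y, step (int n) s y} | y s. y \<in> coords n} \<rparr>"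

lemma verts_coord_graph [simp]: "verts (coord_graph n) = coords n"
  by (simp add: coord_graph_def)

lemma finite_coords [simp]: "finite (coords n)"
  by (simp add: coords_def)

lemma card_coords: "card (coords n) = 12 * n"
  by (simp add: coords_def card_cartesian_product)

lemma step_in_coords: "n \<ge> 1 \<Longrightarrow> y \<in> coords n \<Longrightarrow> step (int n) s y \<in> coords n"
  by (cases y; cases s) (auto simp: coords_def)

lemma step_step: "y \<in> coords n \<Longrightarrow> step (int n) s (step (int n) s y) = y"
  by (cases y; cases s) (auto simp: coords_def mod_simps)

lemma step_neq: "y \<in> coords n \<Longrightarrow> step (int n) s y \<noteq> y"
  by (cases y; cases s) (auto simp: coords_def)

text \<open>The three steps lead to first coordinates congruent to \<open>x\<close>,
  \<open>x + e\<close> and \<open>x + 2 * e\<close>, which are distinct modulo 3.\<close>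

lemma step_eq_iff:
  assumes "y \<in> coords n"
  shows "step (int n) s y = step (int n) t y \<longleftrightarrow> s = t"
proof -
  obtain x e k d where y: "y = (x, e, k, d)" by (cases y)
  then have "x \<in> {0, 1, 2}" "e \<in> {1, -1}"
    using assms by (auto simp: coords_def)
  then show ?thesis
    unfolding y by (cases s; cases t) auto
qed

lemma UNIV_gen: "UNIV = {A, B, C}"
  using gen.exhaust by auto

lemma coord_graph_edge_iff:
  assumes "u \<in> coords n" "v \<in> coords n"
  shows "{u, v} \<in> edges (coord_graph n) \<longleftrightarrow> (\<exists>s. v = step (int n) s u)"
proof
  assume "{u, v} \<in> edges (coord_graph n)"
  then obtain y s where "y \<in> coords n" "{u, v} = {y, step (int n) s y}"
    by (auto simp: coord_graph_def)
  \<comment> \<open>The edge may be presented from its other end; the generators being involutions,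
    the same \<open>s\<close> leads back.\<close>
  then show "\<exists>s. v = step (int n) s u"
    using step_step[of y n s, symmetric] by (auto simp: doubleton_eq_iff)
next
  assume "\<exists>s. v = step (int n) s u"
  then show "{u, v} \<in> edges (coord_graph n)"
    using assms(1) by (simp only: coord_graph_def ugraph.simps) blast
qed

lemma nbhd_coord_graph:
  assumes "n \<ge> 1" "y \<in> coords n"
  shows "nbhd (coord_graph n) y = range (\<lambda>s. step (int n) s y)"
proof -
  have "nbhd (coord_graph n) y = {u \<in> coords n. {y, u} \<in> edges (coord_graph n)}"
    by (simp add: nbhd_def insert_commute)
  also have "\<dots> = {u \<in> coords n. \<exists>s. u = step (int n) s y}"
    using coord_graph_edge_iff[OF assms(2)] by blast
  also have "\<dots> = range (\<lambda>s. step (int n) s y)"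
    using step_in_coords[OF assms] by blast
  finally show ?thesis .
qed

lemma card_nbhd_coord_graph:
  assumes "n \<ge> 1" "y \<in> coords n"
  shows "card (nbhd (coord_graph n) y) = 3"
proof -
  have "card (range (\<lambda>s. step (int n) s y)) = card (UNIV :: gen set)"
    using assms by (intro card_image) (simp add: inj_on_def step_eq_iff)
  then show ?thesis
    using assms by (simp add: nbhd_coord_graph UNIV_gen)
qed

text \<open>A bijection commuting with the steps preserves edges together with their labels; it is
  applied to translations.\<close>

lemma graph_iso_coord_graph:
  assumes "bij_betw g (coords n) (coords n)"
    and "\<And>s y. y \<in> coords n \<Longrightarrow> g (step (int n) s y) = step (int n) s (g y)" and "n \<ge> 1"
  shows "graph_iso g (coord_graph n) (coord_graph n)"
proof -
  have "{u, v} \<in> edges (coord_graph n) \<longleftrightarrow> {g u, g v} \<in> edges (coord_graph n)"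
    if uv: "u \<in> coords n" "v \<in> coords n" for u v
  proof -
    have g: "g u \<in> coords n" "g v \<in> coords n"
      using assms(1) uv by (auto simp: bij_betw_def)
    have "g v = step (int n) s (g u) \<longleftrightarrow> v = step (int n) s u" for s
      using assms(1) uv step_in_coords[OF assms(3) uv(1)] inj_on_eq_iff[of g "coords n"]
      by (simp add: bij_betw_def flip: assms(2))
    then show ?thesis
      by (simp add: coord_graph_edge_iff uv g)
  qed
  then show ?thesis
    using assms(1) by (simp add: graph_iso_def)
qed

text \<open>This is left multiplication by the first argument. A reflection inverts rotations, so
  the signs \<open>e\<close> and \<open>d\<close> act on the rotation parts \<open>x'\<close> and
  \<open>k'\<close>. Left multiplication commutes with the right multiplications
  \<open>step\<close>.\<close>

fun translation :: "nat \<Rightarrow> coord \<Rightarrow> coord \<Rightarrow> coord" where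
  "translation n (x, e, k, d) (x', e', k', d') =
     ((x + e * x') mod 3, e * e', (k + d * k') mod int n, d * d')"

lemma translation_step:
  "translation n y (step (int n) s y') = step (int n) s (translation n y y')"
proof -
  obtain x e k d x' e' k' d' where y: "y = (x, e, k, d)" "y' = (x', e', k', d')"
    by (cases y, cases y')
  show ?thesis
    unfolding y
  proof (cases s)
    case B
    have "(x + e * ((x' + e') mod 3)) mod 3 = ((x + e * x') mod 3 + e * e') mod 3"
      by (metis (no_types, opaque_lifting) distrib_left add.assoc mod_add_left_eq mod_add_right_eq
          mod_mult_right_eq)
    then show "translation n (x, e, k, d) (step (int n) s (x', e', k', d'))
        = step (int n) s (translation n (x, e, k, d) (x', e', k', d'))"
      by (simp add: B)
  next
    case C
    have "(x + e * ((x' + 2 * e') mod 3)) mod 3 = ((x + e * x') mod 3 + 2 * (e * e')) mod 3"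
      "(k + d * ((k' - d') mod int n)) mod int n = ((k + d * k') mod int n - d * d') mod int n"
      by (metis (no_types, opaque_lifting) distrib_left add.assoc mod_add_left_eq mod_add_right_eq
          mod_mult_right_eq mult.left_commute,
        metis (no_types, opaque_lifting) right_diff_distrib add_diff_eq mod_diff_left_eq
          mod_add_right_eq mod_mult_right_eq)
    then show "translation n (x, e, k, d) (step (int n) s (x', e', k', d'))
        = step (int n) s (translation n (x, e, k, d) (x', e', k', d'))"
      by (simp add: C)
  qed simp
qed

lemma translation_origin: "y \<in> coords n \<Longrightarrow> translation n y origin = y"
  by (cases y) (auto simp: coords_def origin_def)

lemma translation_inj:
  assumes "y \<in> coords n"
  shows "inj_on (translation n y) (coords n)"
proof (rule inj_onI)
  fix p q assume pq: "p \<in> coords n" "q \<in> coords n" "translation n y p = translation n y q"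
  obtain x e k d x1 e1 k1 d1 x2 e2 k2 d2
    where y: "y = (x, e, k, d)" "p = (x1, e1, k1, d1)" "q = (x2, e2, k2, d2)"
    by (cases y, cases p, cases q)
  have ed: "e = 1 \<or> e = -1" "d = 1 \<or> d = -1" using assms y by (auto simp: coords_def)
  have "[e * x1 = e * x2] (mod 3)" "[d * k1 = d * k2] (mod int n)"
    using pq(3) by (auto simp: y cong_def[symmetric] cong_add_lcancel)
  then have "[x1 = x2] (mod 3)" "[k1 = k2] (mod int n)"
    using ed by (auto simp: cong_minus_minus_iff)
  then show "p = q"
    using pq ed by (auto simp: y coords_def cong_def)
qed

lemma translation_iso:
  assumes "n \<ge> 1" "y \<in> coords n"
  shows "graph_iso (translation n y) (coord_graph n) (coord_graph n)"
proof (rule graph_iso_coord_graph)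
  have "translation n y ` coords n \<subseteq> coords n"
    using assms by (cases y) (auto simp: coords_def)
  then show "bij_betw (translation n y) (coords n) (coords n)"
    using translation_inj[OF assms(2)] endo_inj_surj[OF finite_coords] by (simp add: bij_betw_def)
qed (use assms translation_step in auto)

lemma origin_in_coords: "n \<ge> 1 \<Longrightarrow> origin \<in> coords n"
  by (simp add: origin_def coords_def)

lemma vertex_transitive_coord_graph:
  assumes "n \<ge> 1"
  shows "vertex_transitive (coord_graph n)"
  unfolding vertex_transitive_def verts_coord_graph
proof (intro ballI)
  fix u v assume uv: "u \<in> coords n" "v \<in> coords n"
  let ?i = "inv_into (verts (coord_graph n)) (translation n u)"
  note i = graph_iso_inv[OF translation_iso[OF assms uv(1)]]
  have "?i u = origin"
    using translation_origin[OF uv(1)] inv_into_f_f[OF translation_inj[OF uv(1)] origin_in_coords[OF assms]]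
    by simp
  then have "(translation n v \<circ> ?i) u = v"
    using translation_origin[OF uv(2)] by simp
  then show "\<exists>\<phi>. graph_iso \<phi> (coord_graph n) (coord_graph n) \<and> \<phi> u = v"
    using graph_iso_compose[OF i translation_iso[OF assms uv(2)]] by blast
qed

text \<open>A vertex with \<open>e = 1\<close> gets the colour of its \<open>x\<close>-coordinate; the three neighbours of a vertex with
  \<open>e = -1\<close> have the three different \<open>x\<close>-coordinates.\<close>

definition coord_colour :: "coord \<Rightarrow> nat set" where
  "coord_colour y = (case y of (x, e, k, d) \<Rightarrow> if e = 1 then {nat x + 1} else {})"

lemma coord_colour_3RDF:
  assumes "n \<ge> 1"
  shows "is_3RDF (coord_graph n) coord_colour"
  unfolding is_3RDF_def verts_coord_graph
proof (intro ballI conjI impI)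
  fix y assume y: "y \<in> coords n"
  obtain x e k d where y': "y = (x, e, k, d)" by (cases y)
  have x: "x \<in> {0, 1, 2}" and e: "e \<in> {1, -1}" using y by (auto simp: y' coords_def)
  show "coord_colour y \<subseteq> {1, 2, 3}"
    using x by (auto simp: coord_colour_def y')
  assume "coord_colour y = {}"
  then have "e = -1" using e by (auto simp: coord_colour_def y')
  then show "(\<Union>u\<in>nbhd (coord_graph n) y. coord_colour u) = {1, 2, 3}"
    unfolding nbhd_coord_graph[OF assms y] unfolding y' UNIV_gen
    using x by (auto simp: coord_colour_def)
qed

lemma coord_colour_weight: "(\<Sum>y\<in>coords n. card (coord_colour y)) = 6 * n"
proof -
  have "(\<Sum>y\<in>coords n. card (coord_colour y))
      = (\<Sum>y\<in>coords n. if y \<in> {0..<3} \<times> {1} \<times> {0..<int n} \<times> {1, -1} then 1 else 0)"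
    by (intro sum.cong) (auto simp: coord_colour_def coords_def)
  also have "\<dots> = card (coords n \<inter> ({0..<3} \<times> {1} \<times> {0..<int n} \<times> {1, -1}))"
    by (simp add: sum.If_cases)
  also have "coords n \<inter> ({0..<3} \<times> {1} \<times> {0..<int n} \<times> {1, -1})
      = {0..<3} \<times> {1} \<times> {0..<int n} \<times> {1, -1}"
    by (auto simp: coords_def)
  finally show ?thesis by (simp add: card_cartesian_product)
qed

section \<open>Closed walks by words\<close>

text \<open>The pair \<open>y\<close>, \<open>s\<close> stands for the arc leaving \<open>y\<close>
  along \<open>s\<close>. The continuations are spelled out by cases, and the origin as a literal,
  so that concrete counts can be evaluated.\<close>

fun word_walks :: "int \<Rightarrow> nat \<Rightarrow> coord \<Rightarrow> gen \<Rightarrow> gen \<Rightarrow> nat" where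
  "word_walks n 0 y s t = (if y = (0, 1, 0, 1) \<and> s = t then 1 else 0)"
| "word_walks n (Suc L) y s t =
     (case s of
       A \<Rightarrow> word_walks n L (step n s y) B t + word_walks n L (step n s y) C t
     | B \<Rightarrow> word_walks n L (step n s y) A t + word_walks n L (step n s y) C t
     | C \<Rightarrow> word_walks n L (step n s y) A t + word_walks n L (step n s y) B t)"

lemma word_walks_Suc:
  "word_walks n (Suc L) y s t = (\<Sum>s'\<in>UNIV - {s}. word_walks n L (step n s y) s' t)"
proof -
  have "UNIV - {A} = {B, C}" "UNIV - {B} = {A, C}" "UNIV - {C} = {A, B}"
    by (auto simp: UNIV_gen)
  then show ?thesis by (cases s) simp_all
qed

text \<open>Generators are involutions, so backtracking means repeating a letter; non-backtracking
  walks are the words without two equal consecutive letters.\<close>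

lemma arc_walks_origin:
  assumes "n \<ge> 1"
  shows "y \<in> coords n \<Longrightarrow>
    arc_walks (coord_graph n) L (y, step (int n) s y) (origin, step (int n) t origin)
      = word_walks (int n) L y s t"
proof (induction L arbitrary: y s)
  case 0
  then show ?case
    by (auto simp: step_eq_iff origin_def[symmetric])
next
  case (Suc L)
  let ?st = "step (int n)"
  let ?z = "?st s y"
  have z: "?z \<in> coords n" by (rule step_in_coords[OF assms Suc.prems])
  have inj: "inj (\<lambda>s'. ?st s' ?z)"
    by (simp add: inj_def step_eq_iff[OF z])
  have "nbhd (coord_graph n) ?z - {y} = range (\<lambda>s'. ?st s' ?z) - (\<lambda>s'. ?st s' ?z) ` {s}"
    by (simp add: nbhd_coord_graph[OF assms z] step_step[OF Suc.prems])
  also have "\<dots> = (\<lambda>s'. ?st s' ?z) ` (UNIV - {s})"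
    by (rule image_set_diff[OF inj, symmetric])
  finally have nb: "nbhd (coord_graph n) ?z - {y} = (\<lambda>s'. ?st s' ?z) ` (UNIV - {s})" .
  have "arc_walks (coord_graph n) (Suc L) (y, ?z) (origin, ?st t origin)
      = (\<Sum>s'\<in>UNIV - {s}. arc_walks (coord_graph n) L (?z, ?st s' ?z) (origin, ?st t origin))"
    using inj_on_subset[OF inj subset_UNIV]
    by (simp only: arc_walks.simps prod.sel nb sum.reindex o_def)
  also have "\<dots> = word_walks (int n) (Suc L) y s t"
    by (simp only: Suc.IH[OF z] word_walks_Suc)
  finally show ?case .
qed

text \<open>A left translation carries the arc labelled \<open>s\<close> at the origin to the one at
  \<open>y\<close>, so the count of closed walks depends on the label alone.\<close>

lemma arc_walks_coord_graph:
  assumes "n \<ge> 1" "y \<in> coords n"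
  shows "arc_walks (coord_graph n) L (y, step (int n) s y) (y, step (int n) s y)
    = word_walks (int n) L origin s s"
proof -
  have o: "origin \<in> coords n" "step (int n) s origin \<in> coords n"
    using assms(1) by (simp_all add: origin_in_coords step_in_coords)
  show ?thesis
    using arc_walks_iso[OF translation_iso[OF assms], of origin "step (int n) s origin" origin
        "step (int n) s origin" L] o
    by (simp add: translation_origin[OF assms(2)] translation_step arc_walks_origin[OF assms(1)])
qed

text \<open>A word of length \<open>L\<close> moves the rotation coordinate by at most \<open>L\<close>, so for \<open>n > L\<close> it closes up in the
  dihedral group iff it closes up in the infinite dihedral group.\<close>

lemma word_walks_large:
  "\<bar>k\<bar> + int L < n \<Longrightarrow> d \<in> {1, -1} \<Longrightarrow>
    word_walks n L (x, e, k mod n, d) s t = word_walks 0 L (x, e, k, d) s t"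
proof (induction L arbitrary: x e k d s)
  case 0
  then have "k mod n = 0 \<longleftrightarrow> k = 0"
    using zdvd_not_zless[of "\<bar>k\<bar>" n] by (auto simp: mod_eq_0_iff_dvd)
  then show ?case by simp
next
  case (Suc L)
  have IH: "word_walks n L (x', e', k' mod n, d') s' t = word_walks 0 L (x', e', k', d') s' t"
    if "\<bar>k'\<bar> \<le> \<bar>k\<bar> + 1" "d' \<in> {1, -1}" for x' e' k' d' s'
    using that Suc.prems by (intro Suc.IH) auto
  have d: "d = 1 \<or> d = -1" using Suc.prems(2) by auto
  have eq: "word_walks n L (x', e', k mod n, d') s' t = word_walks 0 L (x', e', k, d') s' t"
    "word_walks n L (x', e', (k - d) mod n, d') s' t = word_walks 0 L (x', e', k - d, d') s' t"
    if "d' = d \<or> d' = - d" for x' e' d' s'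
    by (rule IH; use d that in auto)+
  show ?case
    by (cases s) (simp_all add: eq mod_diff_left_eq)
qed

text \<open>Among multiples of 3 only 3 and 6 do not exceed the length 6; all larger ones reduce to
  \<open>n = 0\<close> by \<open>word_walks_large\<close>. So three evaluations settle all
  cases.\<close>

lemma word_walks_6:
  assumes "m \<ge> 1"
  shows "word_walks (int (3 * m)) 6 origin A A = 0"
proof -
  have "word_walks 0 6 (0, 1, 0, 1) A A = 0" "word_walks 3 6 (0, 1, 0, 1) A A = 0"
    "word_walks 6 6 (0, 1, 0, 1) A A = 0"
    by code_simp+
  moreover have "m = 1 \<or> m = 2 \<or> int (3 * m) > 6" using assms by auto
  ultimately show ?thesis
    using word_walks_large[of 0 6 "int (3 * m)" 1 0 1 A A] by (auto simp: origin_def)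
qed

text \<open>The single walk alternates \<open>B\<close> and \<open>C\<close>: for
  \<open>n = 3\<close> the product b c has order 3.\<close>

lemma word_walks_6_of_3: "s \<noteq> A \<Longrightarrow> word_walks 3 6 origin s s = 1"
proof -
  have "word_walks 3 6 (0, 1, 0, 1) B B = 1" "word_walks 3 6 (0, 1, 0, 1) C C = 1"
    by code_simp+
  then show "s \<noteq> A \<Longrightarrow> ?thesis" by (cases s) (simp_all add: origin_def)
qed

lemma word_walks_8:
  assumes "m \<ge> 2"
  shows "word_walks (int (3 * m)) 8 origin s s = (if s = A then 6 else 5)"
proof -
  have "word_walks 0 8 (0, 1, 0, 1) A A = 6" "word_walks 0 8 (0, 1, 0, 1) B B = 5"
    "word_walks 0 8 (0, 1, 0, 1) C C = 5" "word_walks 6 8 (0, 1, 0, 1) A A = 6"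
    "word_walks 6 8 (0, 1, 0, 1) B B = 5" "word_walks 6 8 (0, 1, 0, 1) C C = 5"
    by code_simp+
  moreover have "m = 2 \<or> int (3 * m) > 8" using assms by auto
  ultimately show ?thesis
    using word_walks_large[of 0 8 "int (3 * m)" 1 0 1 s s] by (cases s) (auto simp: origin_def)
qed

text \<open>The \<open>A\<close>-edges are recognised by the number of closed walks through them.\<close>

lemma coord_graph_automorphism_A:
  assumes m: "m \<ge> 1" and \<alpha>: "graph_iso \<alpha> (coord_graph (3 * m)) (coord_graph (3 * m))"
    and y: "y \<in> coords (3 * m)"
  shows "\<alpha> (step (int (3 * m)) A y) = step (int (3 * m)) A (\<alpha> y)"
proof -
  define n where "n = 3 * m"
  let ?st = "step (int n)"
  have n: "n \<ge> 1" using m by (simp add: n_def)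
  note \<alpha> = \<alpha>[folded n_def] and y = y[folded n_def]
  have Ay: "?st A y \<in> coords n" by (rule step_in_coords[OF n y])
  have \<alpha>y: "\<alpha> y \<in> coords n" "\<alpha> (?st A y) \<in> coords n"
    using graph_iso_in_verts[OF \<alpha>] y Ay by simp_all
  have "{y, ?st A y} \<in> edges (coord_graph n)"
    using coord_graph_edge_iff[OF y Ay] by blast
  then have "{\<alpha> y, \<alpha> (?st A y)} \<in> edges (coord_graph n)"
    using \<alpha> y Ay by (simp add: graph_iso_def)
  then obtain s where s: "\<alpha> (?st A y) = ?st s (\<alpha> y)"
    using coord_graph_edge_iff[OF \<alpha>y] by blast
  have walks: "word_walks (int n) L origin s s = word_walks (int n) L origin A A" for L
    using arc_walks_iso[OF \<alpha>, of y "?st A y" y "?st A y" L] y Ay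
    by (simp add: s arc_walks_coord_graph[OF n] \<alpha>y(1))
  have "s = A"
  proof (cases "m = 1")
    case True
    then have "int n = 3" by (simp add: n_def)
    then show ?thesis
      using walks[of 6] word_walks_6[OF m] word_walks_6_of_3[of s] by (fold n_def) fastforce
  next
    case False
    then show ?thesis
      using walks[of 8] m word_walks_8[of m s] word_walks_8[of m A]
      by (simp add: n_def split: if_splits)
  qed
  then show ?thesis
    using s by (simp add: n_def)
qed

section \<open>Generalized Petersen graphs\<close>

fun GP_rotate :: "nat \<Rightarrow> nat \<Rightarrow> nat + nat \<Rightarrow> nat + nat" where
  "GP_rotate N d (Inl i) = Inl ((i + d) mod N)"
| "GP_rotate N d (Inr i) = Inr ((i + d) mod N)"

lemma verts_GP_graph: "verts (GP_graph N k) = Inl ` {0..<N} \<union> Inr ` {0..<N}"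
  by (simp add: GP_graph_def)

lemma GP_graph_edge:
  assumes "i < N"
  shows "{Inl i, Inl ((i + 1) mod N)} \<in> edges (GP_graph N k)"
    "{Inl i, Inr i} \<in> edges (GP_graph N k)"
    "{Inr i, Inr ((i + k) mod N)} \<in> edges (GP_graph N k)"
  using assms by (auto simp: GP_graph_def)

lemma GP_rotate_edge:
  assumes "{u, v} \<in> edges (GP_graph N k)"
  shows "{GP_rotate N d u, GP_rotate N d v} \<in> edges (GP_graph N k)"
proof -
  have "\<exists>i < N. {u, v} = {Inl i, Inl ((i + 1) mod N)} \<or> {u, v} = {Inl i, Inr i}
      \<or> {u, v} = {Inr i, Inr ((i + k) mod N)}"
    using assms unfolding GP_graph_def by auto
  then obtain i where i: "i < N" and uv: "{u, v} = {Inl i, Inl ((i + 1) mod N)}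
      \<or> {u, v} = {Inl i, Inr i} \<or> {u, v} = {Inr i, Inr ((i + k) mod N)}"
    by blast
  have j: "(i + d) mod N < N" using i by simp
  have eq: "((i + l) mod N + d) mod N = ((i + d) mod N + l) mod N" for l
    by (simp add: mod_simps add_ac)
  \<comment> \<open>Rotating the edge as a set avoids deciding which end is
    \<open>u\<close>.\<close>
  have "GP_rotate N d ` {u, v} \<in> edges (GP_graph N k)"
    using uv GP_graph_edge[OF j, of k]
    by (elim disjE) (simp_all only: image_insert image_empty GP_rotate.simps eq)
  then show ?thesis by simp
qed

lemma GP_rotate_rotate:
  assumes "u \<in> verts (GP_graph N k)" "d \<le> N"
  shows "GP_rotate N (N - d) (GP_rotate N d u) = u" "GP_rotate N d (GP_rotate N (N - d) u) = u"
proof -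
  have "((i + d) mod N + (N - d)) mod N = i" "((i + (N - d)) mod N + d) mod N = i" if "i < N" for i
    using assms(2) that by (simp_all only: mod_add_left_eq) simp_all
  then show "GP_rotate N (N - d) (GP_rotate N d u) = u" "GP_rotate N d (GP_rotate N (N - d) u) = u"
    using assms(1) by (auto simp: verts_GP_graph)
qed

lemma GP_rotate_iso:
  assumes "d \<le> N"
  shows "graph_iso (GP_rotate N d) (GP_graph N k) (GP_graph N k)"
proof -
  let ?V = "verts (GP_graph N k)"
  have V: "GP_rotate N d' ` ?V \<subseteq> ?V" for d'
    by (auto simp: verts_GP_graph)
  have "bij_betw (GP_rotate N d) ?V ?V"
    by (rule bij_betw_byWitness[of _ "GP_rotate N (N - d)"]) (use V GP_rotate_rotate[OF _ assms] in auto)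
  moreover have "{u, v} \<in> edges (GP_graph N k) \<longleftrightarrow>
      {GP_rotate N d u, GP_rotate N d v} \<in> edges (GP_graph N k)" if "u \<in> ?V" "v \<in> ?V" for u v
    using that GP_rotate_edge[of u v N k d] GP_rotate_edge[of "GP_rotate N d u" "GP_rotate N d v" N k "N - d"]
      GP_rotate_rotate(1)[OF _ assms] by metis
  ultimately show ?thesis by (simp add: graph_iso_def)
qed

text \<open>An invariant of the cycles formed by the \<open>B\<close>- and \<open>C\<close>-edges; it is well defined since \<open>3\<close>
  divides \<open>n\<close>, and its fibres have \<open>2 n\<close> elements.\<close>

fun BC_invariant :: "coord \<Rightarrow> int \<times> int" where
  "BC_invariant (x, e, k, d) =
     ((x + (if e = d then k else - k) - (if e = 1 then 0 else 1)) mod 3, e * d)"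

text \<open>A \<open>B\<close>-step adds \<open>e\<close> to \<open>x\<close>; a
  \<open>C\<close>-step adds \<open>2 * e\<close> to \<open>x\<close> and \<open>- e\<close> to the
  signed \<open>k\<close>. Modulo 3 both add \<open>e\<close> to the sum, and the flip of
  \<open>e\<close> in the last summand compensates. Both signs flip, so \<open>e * d\<close> and the
  sign of \<open>k\<close> persist.\<close>

lemma BC_invariant_step:
  assumes "3 dvd n" "y \<in> coords n" "s \<noteq> A"
  shows "BC_invariant (step (int n) s y) = BC_invariant y"
proof -
  obtain x e k d where y: "y = (x, e, k, d)" by (cases y)
  have ed: "e = 1 \<or> e = -1" "d = 1 \<or> d = -1" using assms(2) by (auto simp: y coords_def)
  obtain c where c: "int n = 3 * c" using assms(1) by auto
  show ?thesis
  proof (cases s)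
    case B
    have "(x + e) mod 3 = x + e + 3 * (- ((x + e) div 3))"
      unfolding minus_mult_div_eq_mod[symmetric] by simp
    then obtain p where p: "(x + e) mod 3 = x + e + 3 * p" ..
    show ?thesis
      using ed unfolding y B step.simps BC_invariant.simps p
      by (auto simp: mod_eq_dvd_iff)
  next
    case C
    \<comment> \<open>Reduction modulo \<open>n = 3 * c\<close> subtracts a multiple of 3, which the
      invariant does not see.\<close>
    obtain q where q: "(k - d) mod int n = k - d + 3 * q"
    proof
      show "(k - d) mod int n = k - d + 3 * (- c * ((k - d) div int n))"
        unfolding minus_mult_div_eq_mod[symmetric] c by simp
    qed
    have "(x + 2 * e) mod 3 = x + 2 * e + 3 * (- ((x + 2 * e) div 3))"
      unfolding minus_mult_div_eq_mod[symmetric] by simp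
    then obtain p where p: "(x + 2 * e) mod 3 = x + 2 * e + 3 * p" ..
    show ?thesis
      using ed unfolding y C step.simps BC_invariant.simps p q
      by (auto simp: mod_eq_dvd_iff)
  qed (use assms(3) in simp)
qed

text \<open>Within a fibre, \<open>k\<close> and \<open>d\<close> determine \<open>e\<close> through
  \<open>e * d\<close>, and then \<open>x\<close> through its residue modulo 3.\<close>

lemma BC_invariant_fibre:
  assumes "U \<subseteq> coords n" "\<And>u. u \<in> U \<Longrightarrow> BC_invariant u = j"
  shows "card U \<le> 2 * n"
proof -
  have "inj_on (\<lambda>(x, e, k, d). (k, d)) U"
  proof (rule inj_onI)
    fix p q assume pq: "p \<in> U" "q \<in> U" "(\<lambda>(x, e, k, d). (k, d)) p = (\<lambda>(x, e, k, d). (k, d)) q"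
    then obtain x1 e1 x2 e2 k d where eq: "p = (x1, e1, k, d)" "q = (x2, e2, k, d)"
      by (cases p, cases q) auto
    have mem: "p \<in> coords n" "q \<in> coords n" using pq assms(1) by auto
    have j: "BC_invariant p = BC_invariant q" using pq assms(2) by simp
    have e: "e1 = e2" using j mem by (auto simp: eq coords_def)
    then have "3 dvd x1 - x2"
      using j by (auto simp: eq mod_eq_dvd_iff split: if_splits)
    then have "x1 = x2"
      using mem by (simp add: eq coords_def mod_eq_dvd_iff[symmetric])
    then show "p = q"
      using e by (simp add: eq)
  qed
  moreover have "(\<lambda>(x, e, k, d). (k, d)) ` U \<subseteq> {0..<int n} \<times> {1, -1}"
    using assms(1) by (auto simp: coords_def)
  ultimately have "card U \<le> card ({0..<int n} \<times> {1, -1 :: int})"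
    by (intro card_inj_on_le) auto
  then show ?thesis by (simp add: card_cartesian_product)
qed

text \<open>Rotations preserve the set of \<open>A\<close>-edges; if an edge of the outer rim were an \<open>A\<close>-edge, then so
  would be the next one, but \<open>A\<close>-edges form a matching.  So the rim stays within one of the
  cycles formed by the \<open>B\<close>- and \<open>C\<close>-edges, which are too short.\<close>

lemma coord_graph_not_GP:
  assumes m: "m \<ge> 1"
  shows "\<not> isomorphic (coord_graph (3 * m)) (GP_graph N k)"
proof
  define n where "n = 3 * m"
  let ?Y = "coord_graph n" and ?P = "GP_graph N k" and ?st = "step (int n)"
  assume "isomorphic (coord_graph (3 * m)) (GP_graph N k)"
  then obtain \<psi> where \<psi>: "graph_iso \<psi> ?Y ?P"
    by (auto simp: isomorphic_def n_def)
  have n: "n \<ge> 1" using m by (simp add: n_def)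
  have "card (verts ?P) = 2 * N"
    unfolding verts_GP_graph by (subst card_Un_disjoint) (auto simp: card_image)
  then have N: "N = 6 * n"
    using isomorphic_card_verts[of ?Y ?P] \<psi> card_coords[of n] by (auto simp: isomorphic_def)
  define \<chi> where "\<chi> = inv_into (verts ?Y) \<psi>"
  have \<chi>: "graph_iso \<chi> ?P ?Y" unfolding \<chi>_def by (rule graph_iso_inv[OF \<psi>])
  have \<chi>_\<psi>: "\<chi> (\<psi> y) = y" if "y \<in> coords n" for y
    using that graph_iso_inj[OF \<psi>] by (simp add: \<chi>_def)
  have \<psi>_\<chi>: "\<psi> (\<chi> u) = u" if "u \<in> verts ?P" for u
    using that \<psi> by (simp add: \<chi>_def graph_iso_def bij_betw_def f_inv_into_f)
  have V: "Inl (i mod N) \<in> verts ?P" for i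
    using N n by (simp add: verts_GP_graph)
  \<comment> \<open>The outer rim seen in the coordinate graph, indexed cyclically by all natural
    numbers.\<close>
  define a where "a i = \<chi> (Inl (i mod N))" for i
  have a: "a i \<in> coords n" for i
    using graph_iso_in_verts[OF \<chi> V] by (simp add: a_def)
  have a_inj: "i mod N = j mod N" if "a i = a j" for i j
    using that inj_onD[OF graph_iso_inj[OF \<chi>] _ V V] by (auto simp: a_def)
  \<comment> \<open>The rotation by one, transported to the coordinate graph; it shifts the rim by
    one place.\<close>
  define \<alpha> where "\<alpha> = \<chi> \<circ> (GP_rotate N 1 \<circ> \<psi>)"
  have \<alpha>: "graph_iso \<alpha> ?Y ?Y"
    unfolding \<alpha>_def using N n by (intro graph_iso_compose[OF _ \<chi>] graph_iso_compose[OF \<psi>] GP_rotate_iso) simp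
  have \<alpha>_a: "\<alpha> (a i) = a (i + 1)" for i
    by (simp add: \<alpha>_def a_def \<psi>_\<chi>[OF V] mod_simps)
  have "BC_invariant (a (i + 1)) = BC_invariant (a i)" for i
  proof -
    have "{Inl (i mod N), Inl ((i mod N + 1) mod N)} \<in> edges ?P"
      using N n by (intro GP_graph_edge) simp
    then have "{Inl (i mod N), Inl ((i + 1) mod N)} \<in> edges ?P"
      by (simp only: mod_add_left_eq)
    then have "{a i, a (i + 1)} \<in> edges ?Y"
      using \<chi> V unfolding graph_iso_def a_def by blast
    then obtain s where s: "a (i + 1) = ?st s (a i)"
      using coord_graph_edge_iff[OF a a] by blast
    have "s \<noteq> A"
    proof
      assume "s = A"
      \<comment> \<open>The \<open>A\<close>-edge from \<open>a i\<close> to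
        \<open>a (i + 1)\<close> is shifted to an \<open>A\<close>-edge from
        \<open>a (i + 1)\<close> to \<open>a (i + 2)\<close>. A vertex has only one
        \<open>A\<close>-neighbour, so \<open>a (i + 2) = a i\<close>, although
        \<open>N > 2\<close>.\<close>
      then have "\<alpha> (a (i + 1)) = ?st A (\<alpha> (a i))"
        using coord_graph_automorphism_A[OF m \<alpha>[unfolded n_def] a[unfolded n_def]] s
        by (simp add: n_def)
      then have "\<alpha> (a (i + 1)) = ?st A (a (i + 1))"
        by (simp only: \<alpha>_a)
      also have "\<dots> = a i"
        unfolding s \<open>s = A\<close> by (rule step_step[OF a])
      finally have "a (i + 1 + 1) = a i"
        by (simp only: \<alpha>_a)
      then have "[i + 2 = i + 0] (mod N)"
        using a_inj[of "i + 2" i] by (simp add: cong_def)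
      then have "[2 = 0] (mod N)"
        by (simp only: cong_add_lcancel_nat)
      then show False
        using N n by (simp add: cong_def)
    qed
    then show ?thesis
      using s BC_invariant_step[OF _ a] by (simp add: n_def)
  qed
  then have const: "BC_invariant (a i) = BC_invariant (a 0)" for i
    by (induction i) simp_all
  \<comment> \<open>The rim has \<open>N = 6 * n\<close> distinct vertices, too many for one
    fibre.\<close>
  have "card (a ` {0..<N}) \<le> 2 * n"
    by (rule BC_invariant_fibre[where j = "BC_invariant (a 0)"]) (use a const in blast)+
  moreover have "inj_on a {0..<N}"
    by (rule inj_onI) (use a_inj in \<open>metis atLeastLessThan_iff mod_less\<close>)
  ultimately show False
    using N n by (simp add: card_image)
qed

section \<open>Honeycomb toroidal graphs\<close>

text \<open>The inequalities say precisely that the closed walk never backtracks, also at its base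
  point. The walk is assembled from its last arc backwards.\<close>

lemma hexagon_arc_walks:
  assumes fin: "finite (verts X)" and V: "{x0, x1, x2, x3, x4, x5} \<subseteq> verts X"
    and E: "{x0, x1} \<in> edges X" "{x1, x2} \<in> edges X" "{x2, x3} \<in> edges X"
      "{x3, x4} \<in> edges X" "{x4, x5} \<in> edges X" "{x5, x0} \<in> edges X"
    and neq: "x0 \<noteq> x2" "x1 \<noteq> x3" "x2 \<noteq> x4" "x3 \<noteq> x5" "x4 \<noteq> x0" "x5 \<noteq> x1"
  shows "arc_walks X 6 (x0, x1) (x0, x1) > 0"
proof -
  have nb: "x1 \<in> nbhd X x0" "x2 \<in> nbhd X x1" "x3 \<in> nbhd X x2" "x4 \<in> nbhd X x3" "x5 \<in> nbhd X x4"
    "x0 \<in> nbhd X x5"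
    using V E by (simp_all add: nbhd_def insert_commute)
  note Suc_pos = arc_walks_Suc_pos[OF fin]
  have "arc_walks X 0 (x0, x1) (x0, x1) > 0" by simp
  from Suc_pos[OF nb(1) neq(6)[symmetric] this]
  have "arc_walks X (Suc 0) (x5, x0) (x0, x1) > 0" .
  from Suc_pos[OF nb(6) neq(5)[symmetric] this]
  have "arc_walks X (Suc (Suc 0)) (x4, x5) (x0, x1) > 0" .
  from Suc_pos[OF nb(5) neq(4)[symmetric] this]
  have "arc_walks X (Suc (Suc (Suc 0))) (x3, x4) (x0, x1) > 0" .
  from Suc_pos[OF nb(4) neq(3)[symmetric] this]
  have "arc_walks X (Suc (Suc (Suc (Suc 0)))) (x2, x3) (x0, x1) > 0" .
  from Suc_pos[OF nb(3) neq(2)[symmetric] this]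
  have "arc_walks X (Suc (Suc (Suc (Suc (Suc 0))))) (x1, x2) (x0, x1) > 0" .
  from Suc_pos[OF nb(2) neq(1)[symmetric] this]
  show ?thesis by (simp only: eval_nat_numeral BitM.simps)
qed

text \<open>A suitable vertex is \<open>p (s + 2)\<close>: it lies on the hexagons
  above and below the jump \<open>p (s + 2)\<close> to \<open>q (s + 2)\<close>, and they cover its three edges.\<close>

lemma HTG_vertex_on_hexagons:
  assumes "M \<ge> 1" "even N" "N \<ge> 4" "2 * l \<le> N" "\<not> (M = 1 \<and> l = 1)"
  shows "\<exists>v\<in>verts (HTG_graph M N l). \<exists>U \<subseteq> nbhd (HTG_graph M N l) v. card U = 3 \<and>
    (\<forall>w\<in>U. arc_walks (HTG_graph M N l) 6 (v, w) (v, w) > 0)"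
proof -
  let ?H = "HTG_graph M N l"
  \<comment> \<open>\<open>p\<close> runs along the last column and \<open>q\<close> along the
    first, shifted by \<open>l\<close> so that jumps join equal indices. For \<open>M = 1\<close>
    the two columns coincide, and \<open>pq\<close> and \<open>qp\<close> below exclude the
    collisions that would cause backtracking.\<close>
  define p where "p t = (M - 1, t mod N)" for t
  define q where "q t = (0 :: nat, (t + l) mod N)" for t
  have V: "p t \<in> verts ?H" "q t \<in> verts ?H" for t
    using assms(1,3) by (auto simp: HTG_graph_def p_def q_def)
  have fin: "finite (verts ?H)" by (simp add: HTG_graph_def)
  have vertical: "{(i, t mod N), (i, (t + 1) mod N)} \<in> edges ?H" if "i < M" for i t
  proof -
    have "(t + 1) mod N = (t mod N + 1) mod N" by (simp add: mod_simps)
    moreover have "t mod N < N" using assms(3) by simp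
    ultimately have "\<exists>i' j. {(i, t mod N), (i, (t + 1) mod N)} = {(i', j), (i', (j + 1) mod N)} \<and>
        i' < M \<and> j < N"
      using that by metis
    then show ?thesis by (simp add: HTG_graph_def)
  qed
  have Ep: "{p t, p (t + 1)} \<in> edges ?H" for t
    unfolding p_def using assms(1) by (intro vertical) simp
  have Eq: "{q t, q (t + 1)} \<in> edges ?H" for t
    using vertical[of 0 "t + l"] assms(1) by (simp add: q_def add_ac)
  have Epq: "{p t, q t} \<in> edges ?H" if "even (t + M)" for t
  proof -
    have "t mod N mod 2 = t mod 2"
      using assms(2) by (rule mod_mod_cancel)
    moreover have "t mod 2 = M mod 2" using that by presburger
    ultimately have "[t mod N = M] (mod 2)" by (simp add: cong_def)
    moreover have "t mod N < N" "(t mod N + l) mod N = (t + l) mod N"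
      using assms(3) by (simp_all add: mod_simps)
    ultimately have "\<exists>j. {p t, q t} = {(M - 1, j), (0, (j + l) mod N)} \<and> j < N \<and> [j = M] (mod 2)"
      unfolding p_def q_def by metis
    then show ?thesis by (simp add: HTG_graph_def)
  qed
  have two: "\<not> [t = t + 2] (mod N)" for t
  proof
    assume "[t = t + 2] (mod N)"
    then have "[t + 0 = t + 2] (mod N)" by simp
    then have "[0 = 2] (mod N)" by (simp only: cong_add_lcancel_nat)
    then show False using assms(3) by (simp add: cong_def)
  qed
  have pp: "p t \<noteq> p (t + 2)" for t
    using two by (simp add: p_def cong_def)
  have qq: "q t \<noteq> q (t + 2)" for t
    using two[of "t + l"] by (simp add: q_def cong_def add_ac)
  have pq: "p t \<noteq> q (t + 1)" for t
  proof
    assume eq: "p t = q (t + 1)"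
    then have "M = 1" "t mod N = (t + (1 + l)) mod N"
      using assms(1) by (auto simp: p_def q_def add_ac)
    then have "[t + 0 = t + (1 + l)] (mod N)" by (simp add: cong_def)
    then have "[0 = 1 + l] (mod N)" by (simp only: cong_add_lcancel_nat)
    moreover have "1 + l < N" using assms(3,4) by linarith
    ultimately show False by (simp add: cong_def)
  qed
  \<comment> \<open>This collision happens exactly in the excluded case \<open>M = 1\<close>,
    \<open>l = 1\<close>.\<close>
  have qp: "p (t + 1) \<noteq> q t" for t
  proof
    assume eq: "p (t + 1) = q t"
    then have "M = 1" "[t + 1 = t + l] (mod N)"
      using assms(1) by (auto simp: p_def q_def cong_def)
    then have "[1 = l] (mod N)" by (simp only: cong_add_lcancel_nat)
    moreover have "l < N" using assms(3,4) by linarith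
    ultimately have "l = 1" using assms(3) by (simp add: cong_def)
    then show False using assms(5) \<open>M = 1\<close> by simp
  qed
  \<comment> \<open>With the parity of \<open>M\<close>, the indices \<open>s\<close>,
    \<open>s + 2\<close> and \<open>s + 4\<close> carry jumps; starting below the chosen vertex
    avoids subtraction of naturals.\<close>
  define s where "s = M"
  have even: "even (s + M)" "even (s + 2 + M)" "even (s + 4 + M)" by (simp_all add: s_def)
  have add: "s + 1 + 1 = s + 2" "s + 2 + 1 = s + 3" "s + 3 + 1 = s + 4" "s + 2 + 2 = s + 4" by simp_all
  let ?v = "p (s + 2)"
  let ?U = "{p (s + 3), p (s + 1), q (s + 2)}"
  note E = Ep[of "s"] Ep[of "s + 1"] Ep[of "s + 2"] Ep[of "s + 3"]
    Eq[of "s"] Eq[of "s + 1"] Eq[of "s + 2"] Eq[of "s + 3"] Epq[OF even(1)] Epq[OF even(2)]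
    Epq[OF even(3)]
  note E = E[unfolded add]
  note neq = pp[of s] pp[of "s + 2"] qq[of s] qq[of "s + 2"] pq[of s] pq[of "s + 1"] pq[of "s + 2"]
    pq[of "s + 3"] qp[of s] qp[of "s + 1"] qp[of "s + 2"] qp[of "s + 3"]
  note neq = neq[unfolded add]
  have "?U \<subseteq> nbhd ?H ?v"
    using V E by (simp add: nbhd_def insert_commute numeral_eq_Suc)
  moreover have "card ?U = 3"
    using pp[of "s + 1"] neq by (simp add: numeral_eq_Suc eq_commute)
  moreover have "arc_walks ?H 6 (?v, w) (?v, w) > 0" if "w \<in> ?U" for w
  proof -
    have "arc_walks ?H 6 (?v, p (s + 3)) (?v, p (s + 3)) > 0"
      by (rule hexagon_arc_walks[OF fin, of _ _ "p (s + 4)" "q (s + 4)" "q (s + 3)" "q (s + 2)"])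
        (use V E neq in \<open>simp_all add: insert_commute numeral_eq_Suc eq_commute\<close>)
    moreover have "arc_walks ?H 6 (?v, p (s + 1)) (?v, p (s + 1)) > 0"
      by (rule hexagon_arc_walks[OF fin, of _ _ "p s" "q s" "q (s + 1)" "q (s + 2)"])
        (use V E neq in \<open>simp_all add: insert_commute numeral_eq_Suc eq_commute\<close>)
    \<comment> \<open>The upper hexagon again, traversed in the opposite direction.\<close>
    moreover have "arc_walks ?H 6 (?v, q (s + 2)) (?v, q (s + 2)) > 0"
      by (rule hexagon_arc_walks[OF fin, of _ _ "q (s + 3)" "q (s + 4)" "p (s + 4)" "p (s + 3)"])
        (use V E neq in \<open>simp_all add: insert_commute numeral_eq_Suc eq_commute\<close>)
    ultimately show ?thesis using that by blast
  qed
  ultimately show ?thesis using V by blast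
qed

text \<open>For these parameters the jumps are vertical edges, so the graph is a cycle; a vertex of
  degree at most 2 rules out a cubic graph.\<close>

lemma HTG_degenerate_nbhd:
  assumes "N \<ge> 4"
  shows "card (nbhd (HTG_graph 1 N 1) (0, 0)) \<le> 2"
proof -
  have "nbhd (HTG_graph 1 N 1) (0, 0) \<subseteq> {(0, 1), (0, N - 1)}"
  proof
    fix u assume "u \<in> nbhd (HTG_graph 1 N 1) (0, 0)"
    then obtain j where j: "j < N" "{u, (0, 0)} = {(0, j), (0, (j + 1) mod N)}"
      unfolding nbhd_def HTG_graph_def by auto
    then consider "j = 0" "u = (0, (j + 1) mod N)" | "(j + 1) mod N = 0" "u = (0, j)"
      by (auto simp: doubleton_eq_iff)
    then show "u \<in> {(0, 1), (0, N - 1)}"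
    proof cases
      case 1
      then show ?thesis using assms by simp
    next
      case 2
      then show ?thesis using j(1) by (auto simp: mod_Suc split: if_splits)
    qed
  qed
  then have "card (nbhd (HTG_graph 1 N 1) (0, 0)) \<le> card {(0 :: nat, 1 :: nat), (0, N - 1)}"
    by (rule card_mono[rotated]) simp
  also have "\<dots> \<le> 2" by (simp add: card_insert_if)
  finally show ?thesis .
qed

text \<open>No closed walk of length 6 passes through an \<open>A\<close>-edge.\<close>

lemma coord_graph_not_HTG:
  assumes m: "m \<ge> 1"
  shows "\<not> is_honeycomb_toroidal (coord_graph (3 * m))"
proof
  define n where "n = 3 * m"
  let ?Y = "coord_graph n" and ?st = "step (int n)"
  have n: "n \<ge> 1" using m by (simp add: n_def)
  assume "is_honeycomb_toroidal (coord_graph (3 * m))"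
  then obtain M N l where MNl: "M \<ge> 1" "even N" "N \<ge> 4" "real l \<le> real N / 2"
    and iso: "isomorphic ?Y (HTG_graph M N l)"
    unfolding is_honeycomb_toroidal_def n_def by blast
  let ?H = "HTG_graph M N l"
  obtain \<chi> where \<chi>: "graph_iso \<chi> ?H ?Y"
    using iso graph_iso_inv unfolding isomorphic_def by blast
  have deg: "card (nbhd ?H v) = 3" if v: "v \<in> verts ?H" for v
  proof -
    have "card (\<chi> ` nbhd ?H v) = 3"
      unfolding graph_iso_nbhd[OF \<chi> v, symmetric]
      using card_nbhd_coord_graph[OF n] graph_iso_in_verts[OF \<chi> v] by simp
    then show ?thesis
      using card_image[OF inj_on_subset[OF graph_iso_inj[OF \<chi>] nbhd_subset_verts]] by simp
  qed
  show False
  proof (cases "M = 1 \<and> l = 1")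
    case True
    then show ?thesis
      using deg[of "(0, 0)"] HTG_degenerate_nbhd[OF MNl(3)] MNl(3) by (simp add: HTG_graph_def)
  next
    case False
    have "2 * l \<le> N" using MNl(4) by linarith
    then obtain v U where v: "v \<in> verts ?H" and U: "U \<subseteq> nbhd ?H v" "card U = 3"
      and walks: "\<And>w. w \<in> U \<Longrightarrow> arc_walks ?H 6 (v, w) (v, w) > 0"
      using HTG_vertex_on_hexagons[OF MNl(1-3) _ False] by blast
    have "finite (nbhd ?H v)"
      using deg[OF v] card.infinite by fastforce
    \<comment> \<open>Three neighbours are all the neighbours, so one of the hexagon edges at
      \<open>v\<close> is mapped to the \<open>A\<close>-edge at \<open>\<chi> v\<close>.\<close>
    then have "U = nbhd ?H v"
      using U deg[OF v] by (intro card_subset_eq) simp_all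
    moreover have \<chi>v: "\<chi> v \<in> coords n"
      using graph_iso_in_verts[OF \<chi> v] by simp
    ultimately have "?st A (\<chi> v) \<in> \<chi> ` U"
      using nbhd_coord_graph[OF n \<chi>v] graph_iso_nbhd[OF \<chi> v] by auto
    then obtain w where w: "w \<in> U" "?st A (\<chi> v) = \<chi> w" by blast
    have "w \<in> verts ?H" using subsetD[OF nbhd_subset_verts[of ?H v]] w(1) U(1) by blast
    then have "arc_walks ?Y 6 (\<chi> v, \<chi> w) (\<chi> v, \<chi> w) > 0"
      using arc_walks_iso[OF \<chi>, of v w v w 6] v walks[OF w(1)] by simp
    then show ?thesis
      using arc_walks_coord_graph[OF n \<chi>v, of 6 A] word_walks_6[OF m]
      unfolding w(2) by (simp add: n_def)
  qed
qed

section \<open>The graphs $X_n$ in coordinates\<close>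

text \<open>The two products of transpositions are the 3-cycle (1 2 3) and its square; composition
  is from right to left.\<close>

definition S3_elem :: "int \<Rightarrow> int \<Rightarrow> nat \<Rightarrow> nat" where
  "S3_elem x e =
     (if x = 0 then id else if x = 1 then transpose 1 2 \<circ> transpose 2 3
      else transpose 1 2 \<circ> transpose 1 3) \<circ> (if e = 1 then id else transpose 1 2)"

lemma S3_elem_step:
  assumes "x \<in> {0..<3}" "e \<in> {1, -1}"
  shows "S3_elem x e \<circ> transpose 1 2 = S3_elem x (- e)"
    "S3_elem x e \<circ> transpose 1 3 = S3_elem ((x + e) mod 3) (- e)"
    "S3_elem x e \<circ> transpose 2 3 = S3_elem ((x + 2 * e) mod 3) (- e)"
proof -
  \<comment> \<open>Permutations are functions on all naturals, so equality is checked at 1, 2, 3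
    and at a generic other point.\<close>
  have ext: "f = g" if "f 1 = g 1" "f 2 = g 2" "f 3 = g 3"
    "\<And>i. i \<noteq> 1 \<Longrightarrow> i \<noteq> 2 \<Longrightarrow> i \<noteq> 3 \<Longrightarrow> f i = g i" for f g :: "nat \<Rightarrow> nat"
    using that by (metis HOL.ext)
  have "x = 0 \<or> x = 1 \<or> x = 2" "e = 1 \<or> e = -1" using assms by auto
  then show "S3_elem x e \<circ> transpose 1 2 = S3_elem x (- e)"
    "S3_elem x e \<circ> transpose 1 3 = S3_elem ((x + e) mod 3) (- e)"
    "S3_elem x e \<circ> transpose 2 3 = S3_elem ((x + 2 * e) mod 3) (- e)"
    by (elim disjE; (intro ext; simp add: S3_elem_def transpose_def))+
qed

lemma S3_elem_bij:
  "bij_betw (\<lambda>(x, e). S3_elem x e) ({0..<3} \<times> {1, -1}) (carrier (sym_group 3))"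
proof -
  let ?f = "\<lambda>(x, e). S3_elem x e" and ?C = "{0..<3} \<times> {1, -1} :: (int \<times> int) set"
  have inj: "inj_on ?f ?C"
  proof (rule inj_onI)
    fix p q assume pq: "p \<in> ?C" "q \<in> ?C" "?f p = ?f q"
    obtain x e x' e' where eq: "p = (x, e)" "q = (x', e')" by (cases p, cases q)
    have "x = 0 \<or> x = 1 \<or> x = 2" "x' = 0 \<or> x' = 1 \<or> x' = 2" "e = 1 \<or> e = -1" "e' = 1 \<or> e' = -1"
      using pq by (auto simp: eq)
    moreover have "S3_elem x e 1 = S3_elem x' e' 1" "S3_elem x e 2 = S3_elem x' e' 2"
      using pq(3) by (simp_all add: eq)
    ultimately show "p = q"
      unfolding eq by (elim disjE) (simp_all add: S3_elem_def transpose_def)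
  qed
  have "S3_elem x e permutes {1..3}" for x e
    unfolding S3_elem_def by (auto intro!: permutes_compose permutes_swap_id permutes_id)
  then have sub: "?f ` ?C \<subseteq> carrier (sym_group 3)"
    by (auto simp: sym_group_carrier)
  \<comment> \<open>Surjectivity follows by counting: both sides have six elements.\<close>
  have "card (carrier (sym_group 3)) = 6"
    by (simp add: sym_group_def card_permutations[OF HOL.refl] fact_numeral)
  moreover have "card (?f ` ?C) = 6"
    by (simp add: card_image[OF inj] card_cartesian_product)
  moreover have "finite (carrier (sym_group 3))"
    by (simp add: sym_group_def finite_permutations)
  ultimately have "?f ` ?C = carrier (sym_group 3)"
    using sub by (intro card_subset_eq) simp_all
  then show ?thesis using inj by (simp add: bij_betw_def)
qed

section \<open>The presented dihedral group: normal forms and their uniqueness\<close>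

fun dih_act :: "dih_gen \<times> bool \<Rightarrow> int \<times> int \<Rightarrow> int \<times> int" where
  "dih_act (Gen_r, b) (k, d) = (if b then k + d else k - d, d)"
| "dih_act (Gen_z, b) (k, d) = (k, - d)"

lemma fold_dih_act_cong:
  "[k = k'] (mod int n) \<Longrightarrow>
    [fst (fold dih_act w (k, d)) = fst (fold dih_act w (k', d))] (mod int n) \<and>
    snd (fold dih_act w (k, d)) = snd (fold dih_act w (k', d))"
proof (induction w arbitrary: k k' d)
  case (Cons l w)
  obtain x b where l: "l = (x, b)" by (cases l)
  show ?case
  proof (cases x)
    case Gen_r
    have "[(if b then k + d else k - d) = (if b then k' + d else k' - d)] (mod int n)"
      using Cons.prems by (simp add: cong_add_rcancel cong_diff)
    from Cons.IH[OF this] show ?thesis by (simp add: l Gen_r)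
  next
    case Gen_z
    from Cons.IH[OF Cons.prems] show ?thesis by (simp add: l Gen_z)
  qed
qed simp

lemma fold_dih_act_replicate:
  "fold dih_act (replicate j (Gen_r, True)) (k, d) = (k + int j * d, d)"
  by (induction j arbitrary: k) (simp_all add: algebra_simps)

text \<open>Reading a word from left to right, \<open>dih_act\<close> multiplies on the right in the
  infinite dihedral group. The relator for r shifts \<open>k\<close> by a multiple of
  \<open>n\<close>, and the other two act as the identity; so modulo \<open>n\<close> the action
  descends to the presented group. This later separates the normal forms.\<close>

lemma fold_dih_act_pres_eq:
  "pres_eq (dih_relators n) u v \<Longrightarrow>
    [fst (fold dih_act u (k, d)) = fst (fold dih_act v (k, d))] (mod int n) \<and>
    snd (fold dih_act u (k, d)) = snd (fold dih_act v (k, d))"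
proof (induction arbitrary: k d rule: pres_eq.induct)
  case (sym v w)
  then show ?case by (simp add: cong_sym)
next
  case (trans u v w)
  then show ?case by (metis cong_trans)
next
  case (cancel u x b v)
  have "fold dih_act [(x, b), (x, \<not> b)] (k, d) = (k, d)" for k d
    by (cases x) auto
  then have "fold dih_act (u @ [(x, b), (x, \<not> b)] @ v) (k, d) = fold dih_act (u @ v) (k, d)"
    by (cases "fold dih_act u (k, d)") simp
  then show ?case by simp
next
  case (relator w u v)
  obtain k' d' where s: "fold dih_act u (k, d) = (k', d')" by (cases "fold dih_act u (k, d)")
  have "[fst (fold dih_act w (k', d')) = k'] (mod int n) \<and> snd (fold dih_act w (k', d')) = d'"
    using relator by (auto simp: dih_relators_def fold_dih_act_replicate cong_def simp del: fold_replicate)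
  \<comment> \<open>The relator \<open>w\<close> may change \<open>k'\<close> by a multiple of
    \<open>n\<close>, so the remaining word \<open>v\<close> starts from congruent, not equal,
    states.\<close>
  then show ?case
    using fold_dih_act_cong[of "fst (fold dih_act w (k', d'))" k' n v d']
    by (cases "fold dih_act w (k', d')") (simp add: s)
qed simp

definition dih_elem :: "nat \<Rightarrow> int \<Rightarrow> int \<Rightarrow> dih_gen gword set" where
  "dih_elem n k d = dih_r n [^]\<^bsub>dihedral_group n\<^esub> k \<otimes>\<^bsub>dihedral_group n\<^esub>
     (if d = 1 then \<one>\<^bsub>dihedral_group n\<^esub> else dih_z n)"

context
  fixes n :: nat and D (structure) and R Z
  defines "D \<equiv> dihedral_group n" and "R \<equiv> dih_r n" and "Z \<equiv> dih_z n"
begin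

lemma group_D: "group D"
  by (simp add: D_def dihedral_group_def presented_group_is_group)

interpretation D: group D by (rule group_D)

lemma pres_class_in_D: "pres_class (dih_relators n) w \<in> carrier D"
  by (simp add: D_def dihedral_group_def presented_group_def)

lemma R_Z_in_D: "R \<in> carrier D" "Z \<in> carrier D"
  by (simp_all add: R_def Z_def dih_r_def dih_z_def pres_class_in_D)

lemma pres_class_append:
  "pres_class (dih_relators n) (u @ v) = pres_class (dih_relators n) u \<otimes> pres_class (dih_relators n) v"
  by (simp add: D_def dihedral_group_def presented_group_mult)

lemma pres_class_Nil: "pres_class (dih_relators n) [] = \<one>"
  by (simp add: D_def dihedral_group_def presented_group_def)

lemma pres_class_relator: "w \<in> dih_relators n \<Longrightarrow> pres_class (dih_relators n) w = \<one>"
  using pres_eq.relator[of w "dih_relators n" "[]" "[]"]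
  by (simp add: pres_class_eq_iff flip: pres_class_Nil)

lemma pres_class_replicate_r: "pres_class (dih_relators n) (replicate j (Gen_r, True)) = R [^] j"
proof (induction j)
  case 0
  then show ?case by (simp add: pres_class_Nil)
next
  case (Suc j)
  have "pres_class (dih_relators n) (replicate j (Gen_r, True) @ [(Gen_r, True)]) = R [^] j \<otimes> R"
    by (simp only: pres_class_append Suc.IH) (simp add: R_def dih_r_def)
  then show ?case by (simp add: replicate_append_same)
qed

lemma R_pow_n: "R [^] n = \<one>"
  unfolding pres_class_replicate_r[symmetric]
  by (rule pres_class_relator) (simp add: dih_relators_def)

lemma Z_Z: "Z \<otimes> Z = \<one>"
  unfolding Z_def dih_z_def pres_class_append[symmetric]
  by (rule pres_class_relator) (simp add: dih_relators_def)

lemma Z_R: "Z \<otimes> R = inv R \<otimes> Z"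
proof -
  have "pres_class (dih_relators n) ([(Gen_z, True), (Gen_r, True)] @ [(Gen_z, True), (Gen_r, True)])
      = \<one>"
    by (rule pres_class_relator) (simp add: dih_relators_def)
  moreover have "pres_class (dih_relators n) ([(Gen_z, True)] @ [(Gen_r, True)]) = Z \<otimes> R"
    by (simp only: pres_class_append) (simp add: Z_def R_def dih_z_def dih_r_def)
  ultimately have "(Z \<otimes> R) \<otimes> (Z \<otimes> R) = \<one>"
    by (simp only: pres_class_append[of "[(Gen_z, True), (Gen_r, True)]"]) simp
  then have "Z \<otimes> R = inv (Z \<otimes> R)"
    using R_Z_in_D by (simp add: D.inv_equality)
  also have "\<dots> = inv R \<otimes> inv Z"
    using R_Z_in_D by (simp add: D.inv_mult_group)
  also have "inv Z = Z"
    using R_Z_in_D Z_Z by (simp add: D.inv_equality)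
  finally show ?thesis .
qed

lemma Z_inv_R: "Z \<otimes> inv R = R \<otimes> Z"
proof -
  have "R \<otimes> Z \<otimes> R = Z"
    using R_Z_in_D by (simp add: D.m_assoc Z_R) (simp flip: D.m_assoc)
  then show ?thesis
    using R_Z_in_D by (metis D.inv_solve_right' D.m_closed)
qed

lemma R_pow_add: "R [^] (k + 1 :: int) = R [^] k \<otimes> R" "R [^] (k - 1 :: int) = R [^] k \<otimes> inv R"
  using R_Z_in_D by (simp_all add: D.int_pow_mult D.int_pow_diff)

lemma dih_elem_mult:
  assumes "d = 1 \<or> d = -1"
  shows "dih_elem n k d \<otimes> R = dih_elem n (k + d) d"
    and "dih_elem n k d \<otimes> inv R = dih_elem n (k - d) d"
    and "dih_elem n k d \<otimes> Z = dih_elem n k (- d)"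
proof -
  have c: "R [^] k \<in> carrier D" "inv R \<in> carrier D" using R_Z_in_D by simp_all
  note defs = dih_elem_def[of n, folded D_def R_def Z_def]
  show "dih_elem n k d \<otimes> R = dih_elem n (k + d) d"
    "dih_elem n k d \<otimes> inv R = dih_elem n (k - d) d"
    "dih_elem n k d \<otimes> Z = dih_elem n k (- d)"
    using assms c R_Z_in_D R_pow_add[of k]
    by (auto simp: defs D.m_assoc Z_R Z_inv_R Z_Z)
qed

lemma dih_elem_mod: "dih_elem n (k mod int n) d = dih_elem n k d"
proof -
  have "R [^] k = R [^] (k mod int n + int n * (k div int n))" by simp
  also have "\<dots> = R [^] (k mod int n) \<otimes> (R [^] int n) [^] (k div int n)"
    using R_Z_in_D by (simp only: D.int_pow_mult D.int_pow_pow)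
  also have "\<dots> = R [^] (k mod int n)"
    using R_Z_in_D by (simp add: int_pow_int R_pow_n)
  finally show ?thesis
    by (simp add: dih_elem_def flip: D_def R_def)
qed

lemma dih_elem_step:
  assumes "d \<in> {1, -1}"
  shows "dih_elem n k d \<otimes> Z = dih_elem n k (- d)"
    and "dih_elem n k d \<otimes> (Z \<otimes> R) = dih_elem n ((k - d) mod int n) (- d)"
proof -
  have d: "d = 1 \<or> d = -1" "- d = 1 \<or> - d = -1" using assms by auto
  have "dih_elem n k d \<in> carrier D"
    using R_Z_in_D by (simp add: dih_elem_def flip: D_def R_def Z_def)
  then have "dih_elem n k d \<otimes> (Z \<otimes> R) = dih_elem n k d \<otimes> Z \<otimes> R"
    using R_Z_in_D by (simp add: D.m_assoc)
  also have "\<dots> = dih_elem n (k + - d) (- d)"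
    by (simp only: dih_elem_mult(3)[OF d(1)] dih_elem_mult(1)[OF d(2)])
  finally show "dih_elem n k d \<otimes> (Z \<otimes> R) = dih_elem n ((k - d) mod int n) (- d)"
    by (simp add: dih_elem_mod)
qed (rule dih_elem_mult(3), use assms in auto)

text \<open>Appending a letter multiplies on the right by \<open>R\<close>, \<open>inv R\<close> or
  \<open>Z\<close>, which keeps the normal form by \<open>dih_elem_mult\<close>. This bounds the
  order of the group from above.\<close>

lemma pres_class_dih_elem: "\<exists>k. \<exists>d\<in>{1, -1}. pres_class (dih_relators n) w = dih_elem n k d"
proof (induction w rule: rev_induct)
  case Nil
  have "pres_class (dih_relators n) [] = dih_elem n 0 1"
    by (simp add: dih_elem_def pres_class_Nil flip: D_def R_def)
  then show ?case by blast
next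
  case (snoc l w)
  then obtain k d where d: "d = 1 \<or> d = -1" and w: "pres_class (dih_relators n) w = dih_elem n k d"
    by auto
  obtain x b where l: "l = (x, b)" by (cases l)
  let ?y = "pres_class (dih_relators n) [(x, True)]"
  have y: "?y \<in> carrier D" by (rule pres_class_in_D)
  have "pres_class (dih_relators n) ([(x, False)] @ [(x, True)]) = \<one>"
    using pres_eq.cancel[of "dih_relators n" "[]" x False "[]"]
    by (simp add: pres_class_eq_iff flip: pres_class_Nil)
  then have "pres_class (dih_relators n) [(x, False)] = inv ?y"
    by (simp only: pres_class_append) (simp add: D.inv_equality pres_class_in_D)
  then have "pres_class (dih_relators n) [l] = (if b then ?y else inv ?y)"
    by (simp add: l)
  moreover have "?y = (case x of Gen_r \<Rightarrow> R | Gen_z \<Rightarrow> Z)"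
    by (cases x) (simp_all add: R_def Z_def dih_r_def dih_z_def)
  moreover have "inv Z = Z"
    using R_Z_in_D Z_Z by (simp add: D.inv_equality)
  ultimately have "pres_class (dih_relators n) [l] = R \<or> pres_class (dih_relators n) [l] = inv R \<or>
      pres_class (dih_relators n) [l] = Z"
    by (cases x) auto
  then have "\<exists>k'. \<exists>d'. (d' = 1 \<or> d' = -1) \<and> dih_elem n k d \<otimes> pres_class (dih_relators n) [l] = dih_elem n k' d'"
    using dih_elem_mult[OF d, of k] d by (metis minus_minus)
  then show ?case
    unfolding pres_class_append w by auto
qed

text \<open>Every element has a normal form by \<open>pres_class_dih_elem\<close>, with
  \<open>k\<close> reduced by \<open>dih_elem_mod\<close>; the action of words on coordinates shows
  that it is unique.\<close>

lemma dih_elem_bij: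
  assumes "n \<ge> 1"
  shows "bij_betw (\<lambda>(k, d). dih_elem n k d) ({0..<int n} \<times> {1, -1}) (carrier D)"
proof -
  let ?f = "\<lambda>(k, d). dih_elem n k d" and ?C = "{0..<int n} \<times> {1, -1} :: (int \<times> int) set"
  have word: "dih_elem n k d = pres_class (dih_relators n)
      (replicate (nat k) (Gen_r, True) @ (if d = 1 then [] else [(Gen_z, True)]))"
    if "k \<ge> 0" for k d
  proof -
    have "R [^] k = R [^] nat k" using that by (simp flip: int_pow_int)
    then show ?thesis
      by (simp add: pres_class_append pres_class_replicate_r pres_class_Nil dih_elem_def
          flip: D_def R_def Z_def) (simp add: Z_def dih_z_def)
  qed
  have "inj_on ?f ?C"
  proof (rule inj_onI)
    fix p q assume pq: "p \<in> ?C" "q \<in> ?C" "?f p = ?f q"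
    obtain k d k' d' where eq: "p = (k, d)" "q = (k', d')" by (cases p, cases q)
    \<comment> \<open>Acting on \<open>(0, 1)\<close>, a normal form word returns its own
      coordinates.\<close>
    have act: "fold dih_act (replicate (nat k) (Gen_r, True) @ (if d = 1 then [] else [(Gen_z, True)]))
        (0, 1) = (k, d)" if "(k, d) \<in> ?C" for k d
      using that by (auto simp: fold_dih_act_replicate simp del: fold_replicate)
    have "dih_elem n k d = dih_elem n k' d'" using pq(3) by (simp add: eq)
    moreover have "k \<ge> 0" "k' \<ge> 0" using pq by (simp_all add: eq)
    ultimately have "pres_eq (dih_relators n)
        (replicate (nat k) (Gen_r, True) @ (if d = 1 then [] else [(Gen_z, True)]))
        (replicate (nat k') (Gen_r, True) @ (if d' = 1 then [] else [(Gen_z, True)]))"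
      by (simp only: word pres_class_eq_iff)
    from fold_dih_act_pres_eq[OF this, of 0 1] have "[k = k'] (mod int n)" "d = d'"
      using pq(1,2) by (simp_all only: eq act fst_conv snd_conv)
    then show "p = q"
      using pq(1,2) by (simp add: eq cong_def)
  qed
  moreover have "?f ` ?C = carrier D"
  proof
    show "?f ` ?C \<subseteq> carrier D"
      using R_Z_in_D by (auto simp: dih_elem_def simp flip: D_def R_def Z_def)
    show "carrier D \<subseteq> ?f ` ?C"
    proof
      fix g assume "g \<in> carrier D"
      then obtain w where "g = pres_class (dih_relators n) w"
        by (auto simp: D_def dihedral_group_def presented_group_def)
      then obtain k d where "d \<in> {1, -1}" "g = dih_elem n (k mod int n) d"
        using pres_class_dih_elem[of w] by (auto simp: dih_elem_mod)
      moreover have "k mod int n \<in> {0..<int n}" using assms by simp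
      ultimately show "g \<in> ?f ` ?C" by blast
    qed
  qed
  ultimately show ?thesis by (simp add: bij_betw_def)
qed

end

section \<open>Transfer from the coordinate model to the graphs X_n\<close>

definition X_group :: "nat \<Rightarrow> ((nat \<Rightarrow> nat) \<times> dih_gen gword set) monoid" where
  "X_group n = sym_group 3 \<times>\<times> dihedral_group n"

definition X_gen :: "nat \<Rightarrow> gen \<Rightarrow> (nat \<Rightarrow> nat) \<times> dih_gen gword set" where
  "X_gen n s = (case s of
     A \<Rightarrow> (transpose 1 2, \<one>\<^bsub>dihedral_group n\<^esub>)
   | B \<Rightarrow> (transpose 1 3, dih_z n)
   | C \<Rightarrow> (transpose 2 3, dih_z n \<otimes>\<^bsub>dihedral_group n\<^esub> dih_r n))"

definition X_elem :: "nat \<Rightarrow> coord \<Rightarrow> (nat \<Rightarrow> nat) \<times> dih_gen gword set" where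
  "X_elem n y = (case y of (x, e, k, d) \<Rightarrow> (S3_elem x e, dih_elem n k d))"

lemma X_graph_alt: "X_graph n = cayley_graph (X_group n) (range (X_gen n))"
  by (simp add: X_graph_def X_group_def X_gen_def UNIV_gen)

lemma X_elem_bij:
  assumes "n \<ge> 1"
  shows "bij_betw (X_elem n) (coords n) (carrier (X_group n))"
proof (rule bij_betw_imageI)
  note S3 = S3_elem_bij and dih = dih_elem_bij[OF assms]
  show "inj_on (X_elem n) (coords n)"
  proof (rule inj_onI)
    fix p q assume pq: "p \<in> coords n" "q \<in> coords n" "X_elem n p = X_elem n q"
    obtain x e k d x' e' k' d' where eq: "p = (x, e, k, d)" "q = (x', e', k', d')"
      by (cases p, cases q)
    have "(x, e) = (x', e')"
      using pq by (intro inj_onD[OF bij_betw_imp_inj_on[OF S3]]) (auto simp: eq coords_def X_elem_def)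
    moreover have "(k, d) = (k', d')"
      using pq by (intro inj_onD[OF bij_betw_imp_inj_on[OF dih]]) (auto simp: eq coords_def X_elem_def)
    ultimately show "p = q" by (simp add: eq)
  qed
  have "X_elem n ` coords n = (\<lambda>(x, e). S3_elem x e) ` ({0..<3} \<times> {1, -1}) \<times>
      (\<lambda>(k, d). dih_elem n k d) ` ({0..<int n} \<times> {1, -1})"
    (is "_ = ?F \<times> ?G")
  proof
    show "X_elem n ` coords n \<subseteq> ?F \<times> ?G"
      unfolding coords_def X_elem_def by force
    show "?F \<times> ?G \<subseteq> X_elem n ` coords n"
    proof
      fix g assume "g \<in> ?F \<times> ?G"
      then have g: "fst g \<in> ?F" "snd g \<in> ?G" by (simp_all only: mem_Times_iff)
      from g(1) obtain u where u: "fst g = (case u of (x, e) \<Rightarrow> S3_elem x e)"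
        "u \<in> {0..<3} \<times> {1, -1}" by (rule imageE)
      from g(2) obtain w where w: "snd g = (case w of (k, d) \<Rightarrow> dih_elem n k d)"
        "w \<in> {0..<int n} \<times> {1, -1}" by (rule imageE)
      obtain x e k d where "u = (x, e)" "w = (k, d)"
        by (cases u, cases w)
      with u w have "g = (S3_elem x e, dih_elem n k d)"
        "(x, e) \<in> {0..<3} \<times> {1, -1}" "(k, d) \<in> {0..<int n} \<times> {1, -1}"
        by (simp_all add: prod_eq_iff)
      then have "g = X_elem n (x, e, k, d)" "(x, e, k, d) \<in> coords n"
        by (auto simp: X_elem_def coords_def)
      then show "g \<in> X_elem n ` coords n" by blast
    qed
  qed
  then show "X_elem n ` coords n = carrier (X_group n)"
    by (simp only: bij_betw_imp_surj_on[OF S3] bij_betw_imp_surj_on[OF dih] X_group_def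
        carrier_DirProd)
qed

lemma X_elem_step:
  assumes "y \<in> coords n"
  shows "X_elem n y \<otimes>\<^bsub>X_group n\<^esub> X_gen n s = X_elem n (step (int n) s y)"
proof -
  interpret group "dihedral_group n" by (rule group_D)
  obtain x e k d where y: "y = (x, e, k, d)" by (cases y)
  have xe: "x \<in> {0..<3}" "e \<in> {1, -1}" and d: "d \<in> {1, -1}"
    using assms by (auto simp: y coords_def)
  have "dih_elem n k d \<in> carrier (dihedral_group n)"
    unfolding dih_elem_def using R_Z_in_D by simp
  then show ?thesis
    using S3_elem_step[OF xe] dih_elem_step[OF d, of n k]
    by (cases s) (simp_all add: y X_elem_def X_group_def X_gen_def sym_group_mult)
qed

lemma verts_X_graph: "n \<ge> 1 \<Longrightarrow> verts (X_graph n) = X_elem n ` coords n"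
  by (simp add: X_graph_alt cayley_graph_def bij_betw_imp_surj_on[OF X_elem_bij])

lemma edges_X_graph:
  assumes "n \<ge> 1"
  shows "edges (X_graph n) = (\<lambda>e. X_elem n ` e) ` edges (coord_graph n)"
proof -
  have "edges (X_graph n) = {{g, g \<otimes>\<^bsub>X_group n\<^esub> X_gen n s} | g s. g \<in> X_elem n ` coords n}"
    unfolding bij_betw_imp_surj_on[OF X_elem_bij[OF assms]]
    unfolding X_graph_alt cayley_graph_def ugraph.simps by blast
  also have "\<dots> = {{X_elem n y, X_elem n y \<otimes>\<^bsub>X_group n\<^esub> X_gen n s} | y s. y \<in> coords n}"
    by blast
  also have "\<dots> = {X_elem n ` {y, step (int n) s y} | y s. y \<in> coords n}"
    by (intro Collect_cong ex_cong1) (auto simp: X_elem_step)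
  also have "\<dots> = (\<lambda>e. X_elem n ` e) ` edges (coord_graph n)"
    unfolding coord_graph_def ugraph.simps by blast
  finally show ?thesis .
qed

lemma X_elem_iso:
  assumes "n \<ge> 1"
  shows "graph_iso (X_elem n) (coord_graph n) (X_graph n)"
proof -
  have inj: "inj_on (X_elem n) (coords n)"
    using X_elem_bij[OF assms] by (rule bij_betw_imp_inj_on)
  have "{u, v} \<in> edges (coord_graph n) \<longleftrightarrow> {X_elem n u, X_elem n v} \<in> edges (X_graph n)"
    if uv: "u \<in> coords n" "v \<in> coords n" for u v
  proof
    assume "{u, v} \<in> edges (coord_graph n)"
    then have "X_elem n ` {u, v} \<in> edges (X_graph n)"
      unfolding edges_X_graph[OF assms] by (rule imageI)
    then show "{X_elem n u, X_elem n v} \<in> edges (X_graph n)" by simp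
  next
    assume "{X_elem n u, X_elem n v} \<in> edges (X_graph n)"
    then obtain E where E: "E \<in> edges (coord_graph n)" "X_elem n ` {u, v} = X_elem n ` E"
      by (auto simp: edges_X_graph[OF assms])
    have "E \<subseteq> coords n"
      using E(1) step_in_coords[OF assms] by (auto simp: coord_graph_def)
    then have "{u, v} = E"
      using E(2) uv inj_on_image_eq_iff[OF inj, of "{u, v}" E] by simp
    then show "{u, v} \<in> edges (coord_graph n)" using E(1) by simp
  qed
  then show ?thesis
    using inj by (simp add: graph_iso_def bij_betw_def verts_X_graph[OF assms])
qed

lemma cubic_X_graph:
  assumes "n \<ge> 1"
  shows "cubic (X_graph n)"
proof -
  note iso = X_elem_iso[OF assms]
  have inj: "inj_on (X_elem n) (coords n)"
    using graph_iso_inj[OF iso] by simp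
  have "e \<subseteq> verts (X_graph n) \<and> card e = 2" if e_in: "e \<in> edges (X_graph n)" for e
  proof -
    obtain y s where y: "y \<in> coords n" and e: "e = X_elem n ` {y, step (int n) s y}"
      using e_in by (auto simp: edges_X_graph[OF assms] coord_graph_def)
    have sub: "{y, step (int n) s y} \<subseteq> coords n"
      using y step_in_coords[OF assms y] by simp
    then have "card e = card {y, step (int n) s y}"
      unfolding e by (intro card_image inj_on_subset[OF inj])
    then show ?thesis
      using sub step_neq[OF y, of s] by (auto simp: e verts_X_graph[OF assms])
  qed
  moreover have "card (nbhd (X_graph n) v) = 3" if v_in: "v \<in> verts (X_graph n)" for v
  proof -
    obtain y where y: "y \<in> coords n" "v = X_elem n y"
      using v_in by (auto simp: verts_X_graph[OF assms])
    have "nbhd (coord_graph n) y \<subseteq> coords n"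
      using nbhd_subset_verts[of "coord_graph n" y] by simp
    then show ?thesis
      using card_nbhd_coord_graph[OF assms y(1)] graph_iso_nbhd[OF iso, of y] y
        card_image[OF inj_on_subset[OF inj]] by simp
  qed
  ultimately show ?thesis
    by (simp add: cubic_def simple_graph_def verts_X_graph[OF assms])
qed

lemma is_3RDR_X_graph:
  assumes "n \<ge> 1"
  shows "is_3RDR (X_graph n)"
proof -
  let ?i = "inv_into (coords n) (X_elem n)"
  \<comment> \<open>The colouring of the coordinate model, transported along
    \<open>X_elem n\<close>.\<close>
  let ?f = "coord_colour \<circ> ?i"
  note iso = X_elem_iso[OF assms]
  have inj: "inj_on (X_elem n) (coords n)"
    using graph_iso_inj[OF iso] by simp
  have f: "?f (X_elem n y) = coord_colour y" if "y \<in> coords n" for y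
    using inj that by simp
  show ?thesis
  proof (rule is_3RDR_I[OF cubic_X_graph[OF assms]])
    show "is_3RDF (X_graph n) ?f"
      unfolding is_3RDF_def verts_X_graph[OF assms]
    proof (rule ballI)
      fix v assume "v \<in> X_elem n ` coords n"
      then obtain y where y: "y \<in> coords n" "v = X_elem n y" by blast
      have "nbhd (coord_graph n) y \<subseteq> coords n"
        using nbhd_subset_verts[of "coord_graph n" y] by simp
      then have "?f (X_elem n u) = coord_colour u" if "u \<in> nbhd (coord_graph n) y" for u
        using f that by blast
      then have "(\<Union>u\<in>nbhd (coord_graph n) y. ?f (X_elem n u))
          = (\<Union>u\<in>nbhd (coord_graph n) y. coord_colour u)"
        by (rule SUP_cong[OF HOL.refl])
      then have "(\<Union>u\<in>nbhd (X_graph n) v. ?f u) = (\<Union>u\<in>nbhd (coord_graph n) y. coord_colour u)"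
        unfolding y(2) using graph_iso_nbhd[OF iso, of y] y(1) by (simp only: verts_coord_graph image_image)
      moreover have "coord_colour y \<subseteq> {1, 2, 3} \<and>
          (coord_colour y = {} \<longrightarrow> (\<Union>u\<in>nbhd (coord_graph n) y. coord_colour u) = {1, 2, 3})"
        using coord_colour_3RDF[OF assms] y(1) unfolding is_3RDF_def verts_coord_graph by (rule bspec)
      ultimately show "?f v \<subseteq> {1, 2, 3} \<and> (?f v = {} \<longrightarrow> (\<Union>u\<in>nbhd (X_graph n) v. ?f u) = {1, 2, 3})"
        unfolding y(2) f[OF y(1)] by argo
    qed
    have "(\<Sum>v\<in>verts (X_graph n). card (?f v)) = (\<Sum>y\<in>coords n. card (coord_colour y))"
      unfolding verts_X_graph[OF assms] sum.reindex[OF inj] o_def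
      using f by (intro sum.cong) simp_all
    then show "2 * (\<Sum>v\<in>verts (X_graph n). card (?f v)) = card (verts (X_graph n))"
      by (simp add: coord_colour_weight verts_X_graph[OF assms] card_image[OF inj] card_coords)
  qed
qed

theorem corollary4p8:
  shows "(\<forall>m::nat. m \<ge> 1 \<longrightarrow>
           vertex_transitive (X_graph (3 * m)) \<and>
           is_3RDR (X_graph (3 * m)) \<and>
           card (verts (X_graph (3 * m))) = 36 * m \<and>
           \<not> is_honeycomb_toroidal (X_graph (3 * m)) \<and>
           \<not> is_generalized_petersen (X_graph (3 * m))) \<and>
         (\<forall>m m'::nat. m \<ge> 1 \<longrightarrow> m' \<ge> 1 \<longrightarrow>
           isomorphic (X_graph (3 * m)) (X_graph (3 * m')) \<longrightarrow> m = m')"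
proof -
  have iso: "isomorphic (coord_graph (3 * m)) (X_graph (3 * m))" if "m \<ge> 1" for m
    using X_elem_iso[of "3 * m"] that unfolding isomorphic_def by fastforce
  \<comment> \<open>Stated for an arbitrary \<open>Y\<close>, this turns both exclusions into the
    ones shown for the coordinate model.\<close>
  have trans: "isomorphic (coord_graph (3 * m)) Y" if "m \<ge> 1" "isomorphic (X_graph (3 * m)) Y"
    for m and Y :: "'a ugraph"
    using iso[OF that(1)] that(2) graph_iso_compose unfolding isomorphic_def by blast
  have card: "card (verts (X_graph (3 * m))) = 36 * m" if "m \<ge> 1" for m
    using isomorphic_card_verts[OF iso[OF that]] by (simp add: card_coords)
  have "vertex_transitive (X_graph (3 * m))" if "m \<ge> 1" for m
    using vertex_transitive_iso[OF X_elem_iso vertex_transitive_coord_graph] that by simp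
  moreover have "\<not> is_honeycomb_toroidal (X_graph (3 * m))" if "m \<ge> 1" for m
    using coord_graph_not_HTG[OF that] trans[OF that] unfolding is_honeycomb_toroidal_def by blast
  moreover have "\<not> is_generalized_petersen (X_graph (3 * m))" if "m \<ge> 1" for m
    using coord_graph_not_GP[OF that] trans[OF that] unfolding is_generalized_petersen_def by blast
  moreover have "is_3RDR (X_graph (3 * m))" if "m \<ge> 1" for m
    using that by (intro is_3RDR_X_graph) simp
  \<comment> \<open>The orders \<open>36 * m\<close> differ, so the family is infinite up to
    isomorphism.\<close>
  moreover have "m = m'" if "m \<ge> 1" "m' \<ge> 1" "isomorphic (X_graph (3 * m)) (X_graph (3 * m'))"
    for m m'
    using isomorphic_card_verts[OF that(3)] card that by simp
  ultimately show ?thesis using card by blast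
qed
end
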